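(* Let $\Gamma$ be a finite simply laced graph, $\mathbb{K}$ a commutative ring, and $\{s_{ij}\}$ invertible elements of $\mathbb{K}$ indexed by the edges of $\Gamma$ (with $s_{ij}=s_{ji}$). Let $\Delta=1+\sum s_{ij}l_{ij}\in\mathbb{K}\Gamma$ (sum over all oriented edges $(ij)$) be the generalized Laplace operator. Then there is a unique isomorphism of non-unital algebras $$B^{+}(\Gamma)\cong \mathbb{K}\Gamma_{\Delta},$$ and hence an isomorphism of unital algebras $$B(\Gamma)\cong\widehat{\mathbb{K}\Gamma_{\Delta}},$$ that takes $x_i$ to $e_i$ for every vertex $i$ of $\Gamma$.
   Context: Simply laced: no loops and no multiple edges. $V(\Gamma)$ and $E(\Gamma)$ are the sets of vertices and edges. Algebra $B(\Gamma)$: the unital $\mathbb{K}$-algebra with generators $x_i$, $i\in V(\Gamma)$, and relations: $x_i^2=x_i$ for every $i$; $x_ix_jx_i=s_{ij}^2x_i$ and $x_jx_ix_j=s_{ij}^2x_j$ if $(ij)\in E(\Gamma)$; $x_ix_j=x_jx_i=0$ if $i\neq j$ and $(ij)\notin E(\Gamma)$. $B^+(\Gamma)\subset B(\Gamma)$ is the (augmentation) ideal generated by all $x_i$. Algebra $\mathbb{K}\Gamma$ of the Poincaré groupoid: the $\mathbb{K}$-algebra with free $\mathbb{K}$-basis the homotopy classes (with fixed endpoints) of paths between vertices in $\Gamma$, with multiplication induced by concatenation of paths (zero when paths cannot be concatenated). $e_i$ is the class of the constant path at vertex $i$, $l_{ij}$ is the class of the oriented edge $(ij)$ (so $l_{ij}l_{ji}=e_i$),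 and the unit is $1=\sum_i e_i$. Homotope: for a unital $\mathbb{K}$-algebra $A$ and $\Delta\in A$, $A_\Delta$ is the (possibly non-unital) algebra with the same underlying $\mathbb{K}$-module as $A$ and multiplication $a\cdot_\Delta b=a\Delta b$; $\widehat{A}_\Delta=\mathbb{K}\cdot 1\oplus A_\Delta$ is obtained by adjoining a unit. $\mathbb{K}\Gamma_\Delta$ and $\widehat{\mathbb{K}\Gamma_\Delta}$ denote these for $A=\mathbb{K}\Gamma$. *)

theory Defs
  imports
    "HOL-Algebra.QuotRing"
    "HOL-Algebra.Module"
    "Graph_Theory.Pair_Digraph"
    "Graph_Theory.Vertex_Walk"
begin

no_notation vwalk_join (infixr \<open>\<oplus>\<close> 65)

section \<open>Algebras over a commutative ring\<close>

text \<open>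
  Algebras over a commutative ring \<open>K\<close> are represented by the record \<^type>\<open>module\<close>, which carries
  both the ring structure and the scalar multiplication. (The locale \<^locale>\<open>algebra\<close> of the
  library covers commutative algebras only.) For a non-unital algebra the field \<open>one\<close> of the
  record has no meaning and is never referred to.
\<close>

definition nonunital_algebra_iso ::
    "('k, 'm) ring_scheme \<Rightarrow> ('k, 'a, 'p) module_scheme \<Rightarrow> ('k, 'b, 'q) module_scheme \<Rightarrow> ('a \<Rightarrow> 'b) set"
  where "nonunital_algebra_iso K A B =
    {h. h \<in> hom A B \<and> h \<in> hom (add_monoid A) (add_monoid B) \<and>
        (\<forall>k\<in>carrier K. \<forall>a\<in>carrier A. h (k \<odot>\<^bsub>A\<^esub> a) = k \<odot>\<^bsub>B\<^esub> h a) \<and>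
        bij_betw h (carrier A) (carrier B)}"

definition algebra_iso ::
    "('k, 'm) ring_scheme \<Rightarrow> ('k, 'a, 'p) module_scheme \<Rightarrow> ('k, 'b, 'q) module_scheme \<Rightarrow> ('a \<Rightarrow> 'b) set"
  where "algebra_iso K A B =
    {h. h \<in> ring_iso A B \<and>
        (\<forall>k\<in>carrier K. \<forall>a\<in>carrier A. h (k \<odot>\<^bsub>A\<^esub> a) = k \<odot>\<^bsub>B\<^esub> h a)}"

text \<open>
  The free module on a set \<open>S\<close> (finitely supported functions \<open>S \<rightarrow> K\<close>, extended by zero), with the
  bilinear multiplication induced by a partial operation \<open>m\<close> on \<open>S\<close>: a value of \<open>m\<close> outside \<open>S\<close> means
  that the product of the two basis elements is zero. The unit is the sum of the basis elements in
  the finite set \<open>U\<close>.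
\<close>

definition basis_algebra ::
    "('k, 'm) ring_scheme \<Rightarrow> 'b set \<Rightarrow> ('b \<Rightarrow> 'b \<Rightarrow> 'b) \<Rightarrow> 'b set \<Rightarrow> ('k, 'b \<Rightarrow> 'k) module"
  where "basis_algebra K S m U =
    \<lparr>carrier = {f. f \<in> UNIV \<rightarrow> carrier K \<and> finite {b. f b \<noteq> \<zero>\<^bsub>K\<^esub>} \<and> {b. f b \<noteq> \<zero>\<^bsub>K\<^esub>} \<subseteq> S},
     monoid.mult = (\<lambda>f g c.
       if c \<in> S then
         \<Oplus>\<^bsub>K\<^esub>a\<in>{a. f a \<noteq> \<zero>\<^bsub>K\<^esub>}. \<Oplus>\<^bsub>K\<^esub>b\<in>{b. g b \<noteq> \<zero>\<^bsub>K\<^esub>}. (if m a b = c then f a \<otimes>\<^bsub>K\<^esub> g b else \<zero>\<^bsub>K\<^esub>)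
       else \<zero>\<^bsub>K\<^esub>),
     one = (\<lambda>b. if b \<in> U then \<one>\<^bsub>K\<^esub> else \<zero>\<^bsub>K\<^esub>),
     zero = (\<lambda>b. \<zero>\<^bsub>K\<^esub>),
     add = (\<lambda>f g b. f b \<oplus>\<^bsub>K\<^esub> g b),
     smult = (\<lambda>k f b. k \<otimes>\<^bsub>K\<^esub> f b)\<rparr>"

definition basis_elem :: "('k, 'm) ring_scheme \<Rightarrow> 'b \<Rightarrow> 'b \<Rightarrow> 'k"
  where "basis_elem K b = (\<lambda>c. if c = b then \<one>\<^bsub>K\<^esub> else \<zero>\<^bsub>K\<^esub>)"

definition free_algebra :: "('k, 'm) ring_scheme \<Rightarrow> 'v set \<Rightarrow> ('k, 'v list \<Rightarrow> 'k) module"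
  where "free_algebra K V = basis_algebra K (lists V) (@) {[]}"

text \<open>
  The library quotient \<^const>\<open>FactRing\<close> with the induced scalar multiplication, which is written in
  the style of \<^const>\<open>rcoset_mult\<close>.
\<close>

definition quotient_algebra :: "('k, 'a, 'p) module_scheme \<Rightarrow> 'a set \<Rightarrow> ('k, 'a set) module"
  where "quotient_algebra A I =
    \<lparr>carrier = carrier (A Quot I), monoid.mult = monoid.mult (A Quot I), one = one (A Quot I),
     zero = zero (A Quot I), add = add (A Quot I),
     smult = (\<lambda>k X. \<Union>x\<in>X. I +>\<^bsub>A\<^esub> (k \<odot>\<^bsub>A\<^esub> x))\<rparr>"

definition homotope :: "('k, 'a, 'p) module_scheme \<Rightarrow> 'a \<Rightarrow> ('k, 'a, 'p) module_scheme"
  where "homotope A d = A\<lparr>monoid.mult := \<lambda>a b. a \<otimes>\<^bsub>A\<^esub> d \<otimes>\<^bsub>A\<^esub> b\<rparr>"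

definition unitization ::
    "('k, 'm) ring_scheme \<Rightarrow> ('k, 'a, 'p) module_scheme \<Rightarrow> ('k, 'k \<times> 'a) module"
  where "unitization K A =
    \<lparr>carrier = carrier K \<times> carrier A,
     monoid.mult = (\<lambda>(k, a) (l, b).
       (k \<otimes>\<^bsub>K\<^esub> l, k \<odot>\<^bsub>A\<^esub> b \<oplus>\<^bsub>A\<^esub> l \<odot>\<^bsub>A\<^esub> a \<oplus>\<^bsub>A\<^esub> a \<otimes>\<^bsub>A\<^esub> b)),
     one = (\<one>\<^bsub>K\<^esub>, \<zero>\<^bsub>A\<^esub>),
     zero = (\<zero>\<^bsub>K\<^esub>, \<zero>\<^bsub>A\<^esub>),
     add = (\<lambda>(k, a) (l, b). (k \<oplus>\<^bsub>K\<^esub> l, a \<oplus>\<^bsub>A\<^esub> b)),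
     smult = (\<lambda>r (k, a). (r \<otimes>\<^bsub>K\<^esub> k, r \<odot>\<^bsub>A\<^esub> a))\<rparr>"


section \<open>The algebra $B(\Gamma)$\<close>

text \<open>
  A finite simply laced graph is a \<^locale>\<open>pair_graph\<close>: a finite loop-free symmetric digraph whose
  arcs are pairs of vertices. Its arcs are the oriented edges of the graph, so every edge occurs in
  both orientations.
\<close>

definition B_relations ::
    "('k, 'm) ring_scheme \<Rightarrow> 'v pair_pre_digraph \<Rightarrow> ('v \<Rightarrow> 'v \<Rightarrow> 'k) \<Rightarrow> ('v list \<Rightarrow> 'k) set"
  where "B_relations K G s =
    (let F = free_algebra K (pverts G); x = (\<lambda>i. basis_elem K [i]) in
      {x i \<otimes>\<^bsub>F\<^esub> x i \<ominus>\<^bsub>F\<^esub> x i | i. i \<in> pverts G} \<union>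
      {x i \<otimes>\<^bsub>F\<^esub> x j \<otimes>\<^bsub>F\<^esub> x i \<ominus>\<^bsub>F\<^esub> (s i j [^]\<^bsub>K\<^esub> (2::nat)) \<odot>\<^bsub>F\<^esub> x i | i j. (i, j) \<in> parcs G} \<union>
      {x i \<otimes>\<^bsub>F\<^esub> x j | i j. i \<in> pverts G \<and> j \<in> pverts G \<and> i \<noteq> j \<and> (i, j) \<notin> parcs G})"

definition B_ideal ::
    "('k, 'm) ring_scheme \<Rightarrow> 'v pair_pre_digraph \<Rightarrow> ('v \<Rightarrow> 'v \<Rightarrow> 'k) \<Rightarrow> ('v list \<Rightarrow> 'k) set"
  where "B_ideal K G s = Idl\<^bsub>free_algebra K (pverts G)\<^esub> (B_relations K G s)"

definition B_algebra ::
    "('k, 'm) ring_scheme \<Rightarrow> 'v pair_pre_digraph \<Rightarrow> ('v \<Rightarrow> 'v \<Rightarrow> 'k) \<Rightarrow> ('k, ('v list \<Rightarrow> 'k) set) module"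
  where "B_algebra K G s = quotient_algebra (free_algebra K (pverts G)) (B_ideal K G s)"

definition B_gen ::
    "('k, 'm) ring_scheme \<Rightarrow> 'v pair_pre_digraph \<Rightarrow> ('v \<Rightarrow> 'v \<Rightarrow> 'k) \<Rightarrow> 'v \<Rightarrow> ('v list \<Rightarrow> 'k) set"
  where "B_gen K G s i = B_ideal K G s +>\<^bsub>free_algebra K (pverts G)\<^esub> basis_elem K [i]"

definition B_plus ::
    "('k, 'm) ring_scheme \<Rightarrow> 'v pair_pre_digraph \<Rightarrow> ('v \<Rightarrow> 'v \<Rightarrow> 'k) \<Rightarrow> ('k, ('v list \<Rightarrow> 'k) set) module"
  where "B_plus K G s =
    (B_algebra K G s)\<lparr>carrier := Idl\<^bsub>B_algebra K G s\<^esub> (B_gen K G s ` pverts G)\<rparr>"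


section \<open>The algebra of the Poincare groupoid\<close>

text \<open>
  A path is a nonempty list of successively adjacent vertices, the constant path at \<open>i\<close> being \<open>[i]\<close>.
  Homotopy with fixed endpoints is the equivalence relation generated by inserting and removing
  backtrackings \<open>a, b, a\<close>.
\<close>

inductive homotopic_paths :: "'v pair_pre_digraph \<Rightarrow> 'v vwalk \<Rightarrow> 'v vwalk \<Rightarrow> bool" for G
  where
    refl: "vwalk p (with_proj G) \<Longrightarrow> homotopic_paths G p p"
  | backtrack: "vwalk (p @ [a, b, a] @ q) (with_proj G) \<Longrightarrow>
      homotopic_paths G (p @ [a, b, a] @ q) (p @ [a] @ q)"
  | sym: "homotopic_paths G p q \<Longrightarrow> homotopic_paths G q p"
  | trans: "homotopic_paths G p q \<Longrightarrow> homotopic_paths G q r \<Longrightarrow> homotopic_paths G p r"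

definition homotopy_class :: "'v pair_pre_digraph \<Rightarrow> 'v vwalk \<Rightarrow> 'v vwalk set"
  where "homotopy_class G p = {q. homotopic_paths G p q}"

definition homotopy_classes :: "'v pair_pre_digraph \<Rightarrow> 'v vwalk set set"
  where "homotopy_classes G = homotopy_class G ` {p. vwalk p (with_proj G)}"

text \<open>
  The path \<^term>\<open>vwalk_join p q\<close> runs first through \<open>p\<close> and then through \<open>q\<close>. If the classes cannot
  be concatenated, the result is the empty set, which is not a homotopy class.
\<close>

definition concat_classes ::
    "'v pair_pre_digraph \<Rightarrow> 'v vwalk set \<Rightarrow> 'v vwalk set \<Rightarrow> 'v vwalk set"
  where "concat_classes G c d =
    (\<Union>p\<in>c. \<Union>q\<in>d. if last p = hd q then homotopy_class G (vwalk_join p q) else {})"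

definition groupoid_algebra ::
    "('k, 'm) ring_scheme \<Rightarrow> 'v pair_pre_digraph \<Rightarrow> ('k, 'v vwalk set \<Rightarrow> 'k) module"
  where "groupoid_algebra K G =
    basis_algebra K (homotopy_classes G) (concat_classes G) ((\<lambda>i. homotopy_class G [i]) ` pverts G)"

definition vertex_elem ::
    "('k, 'm) ring_scheme \<Rightarrow> 'v pair_pre_digraph \<Rightarrow> 'v \<Rightarrow> 'v vwalk set \<Rightarrow> 'k"
  where "vertex_elem K G i = basis_elem K (homotopy_class G [i])"

definition edge_elem ::
    "('k, 'm) ring_scheme \<Rightarrow> 'v pair_pre_digraph \<Rightarrow> 'v \<Rightarrow> 'v \<Rightarrow> 'v vwalk set \<Rightarrow> 'k"
  where "edge_elem K G i j = basis_elem K (homotopy_class G [i, j])"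

definition laplace ::
    "('k, 'm) ring_scheme \<Rightarrow> 'v pair_pre_digraph \<Rightarrow> ('v \<Rightarrow> 'v \<Rightarrow> 'k) \<Rightarrow> 'v vwalk set \<Rightarrow> 'k"
  where "laplace K G s =
    \<one>\<^bsub>groupoid_algebra K G\<^esub> \<oplus>\<^bsub>groupoid_algebra K G\<^esub>
    (\<Oplus>\<^bsub>groupoid_algebra K G\<^esub>a\<in>parcs G.
      s (fst a) (snd a) \<odot>\<^bsub>groupoid_algebra K G\<^esub> edge_elem K G (fst a) (snd a))"

definition groupoid_homotope ::
    "('k, 'm) ring_scheme \<Rightarrow> 'v pair_pre_digraph \<Rightarrow> ('v \<Rightarrow> 'v \<Rightarrow> 'k) \<Rightarrow> ('k, 'v vwalk set \<Rightarrow> 'k) module"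
  where "groupoid_homotope K G s = homotope (groupoid_algebra K G) (laplace K G s)"

end

theory Submission
  imports Defs
begin

text \<open>
  The algebra \<open>B\<close> is the quotient of the free algebra on the vertices, and sending \<open>x\<^sub>i\<close> to \<open>e\<^sub>i\<close> sends a
  word \<open>w = i\<^sub>1\<dots>i\<^sub>n\<close> to \<open>e\<^bsub>i\<^sub>1\<^esub> \<Delta> e\<^bsub>i\<^sub>2\<^esub> \<Delta> \<dots> \<Delta> e\<^bsub>i\<^sub>n\<^esub>\<close>. Since \<open>e\<^sub>i \<Delta> e\<^sub>j\<close> is \<open>e\<^sub>i\<close>, \<open>s\<^bsub>ij\<^esub> l\<^bsub>ij\<^esub>\<close> or
  \<open>0\<close>, this product is the class of the walk \<open>w\<close> multiplied by the invertible product of the weights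
  of its edges, or \<open>0\<close> if \<open>w\<close> is not a walk. The map kills the defining relations. Conversely,
  modulo the relations a word that is not a walk vanishes, and a walk divided by its weight
  depends only on its homotopy class, because a backtracking \<open>i, j, i\<close> multiplies both the word
  and the weight by \<open>s\<^bsub>ij\<^esub>\<^sup>2\<close>. So choosing a representative of each class inverts the map.
\<close>

section \<open>Algebras with a multiplicative basis\<close>

text \<open>The homotope need not have a unit, so the argument runs in the unital setting: a
  combination of words is sent to the pair of its coefficient at the empty word and the image of the
  rest. This is a ring homomorphism from the free algebra onto the unitization, and the first
  isomorphism theorem gives the unital isomorphism once the kernel is known to be the ideal of
  relations. That every relation is killed is a computation on words. For the converse, the choice
  of representatives provides a linear section only, with values in the free algebra; it suffices
  that each \<open>f\<close> is congruent, modulo the relations, to its constant term plus the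
  section applied to its image. The ideal \<open>B_plus\<close> consists of the classes with
  vanishing coefficient at the empty word, so the non-unital isomorphism is the second component of
  the unital one. Uniqueness holds because each nonempty word is a product of generators: the
  \<open>x_i\<close> generate this ideal even as a non-unital algebra.\<close>

lemma basis_algebra_carrier_iff:
  "f \<in> carrier (basis_algebra K S m U) \<longleftrightarrow>
    (\<forall>b. f b \<in> carrier K) \<and> finite {b. f b \<noteq> \<zero>\<^bsub>K\<^esub>} \<and> (\<forall>b. b \<notin> S \<longrightarrow> f b = \<zero>\<^bsub>K\<^esub>)"
  by (auto simp: basis_algebra_def)

lemma basis_algebra_simps [simp]:
  "\<zero>\<^bsub>basis_algebra K S m U\<^esub> = (\<lambda>b. \<zero>\<^bsub>K\<^esub>)"
  "\<one>\<^bsub>basis_algebra K S m U\<^esub> = (\<lambda>b. if b \<in> U then \<one>\<^bsub>K\<^esub> else \<zero>\<^bsub>K\<^esub>)"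
  "f \<oplus>\<^bsub>basis_algebra K S m U\<^esub> g = (\<lambda>b. f b \<oplus>\<^bsub>K\<^esub> g b)"
  "k \<odot>\<^bsub>basis_algebra K S m U\<^esub> f = (\<lambda>b. k \<otimes>\<^bsub>K\<^esub> f b)"
  by (simp_all add: basis_algebra_def)

context cring
begin

lemma basis_algebra_carrierI:
  assumes "\<And>b. f b \<in> carrier R" "finite X" "X \<subseteq> S" "\<And>b. b \<notin> X \<Longrightarrow> f b = \<zero>"
  shows "f \<in> carrier (basis_algebra R S m U)"
  using assms by (auto simp: basis_algebra_carrier_iff intro: finite_subset[of _ X])

lemma basis_algebra_module: "Module.module R (basis_algebra R S m U)"
proof -
  let ?A = "basis_algebra R S m U"
  have add: "f \<oplus>\<^bsub>?A\<^esub> g \<in> carrier ?A" if "f \<in> carrier ?A" "g \<in> carrier ?A" for f g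
    by (rule basis_algebra_carrierI[where X = "{b. f b \<noteq> \<zero>} \<union> {b. g b \<noteq> \<zero>}"])
      (use that in \<open>auto simp: basis_algebra_carrier_iff\<close>)
  have smult: "k \<odot>\<^bsub>?A\<^esub> f \<in> carrier ?A" if "k \<in> carrier R" "f \<in> carrier ?A" for k f
    by (rule basis_algebra_carrierI[where X = "{b. f b \<noteq> \<zero>}"])
      (use that in \<open>auto simp: basis_algebra_carrier_iff\<close>)
  show ?thesis
  proof (rule moduleI)
    show "abelian_group ?A"
    proof (rule abelian_groupI)
      fix f assume f: "f \<in> carrier ?A"
      show "\<exists>g\<in>carrier ?A. g \<oplus>\<^bsub>?A\<^esub> f = \<zero>\<^bsub>?A\<^esub>"
        \<comment> \<open>The additive inverse is taken as \<open>(-1) f\<close>, whose membership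
          in the carrier is already known.\<close>
        by (rule bexI[OF _ smult[OF _ f, of "\<ominus> \<one>"]])
          (use f in \<open>auto simp: basis_algebra_carrier_iff l_minus l_neg\<close>)
    qed (use add in \<open>auto simp: basis_algebra_carrier_iff a_ac\<close>)
  qed (use add smult in \<open>auto simp: basis_algebra_carrier_iff l_distr r_distr m_assoc is_cring\<close>)
qed

lemma basis_elem_closed [simp]:
  "b \<in> S \<Longrightarrow> basis_elem R b \<in> carrier (basis_algebra R S m U)"
  by (rule basis_algebra_carrierI[where X = "{b}"]) (auto simp: basis_elem_def)

text \<open>Basis elements span, which is proved by induction on a finite set containing the
  support. Later identities that are linear in each argument are checked on basis elements through
  this rule.\<close>

lemma basis_algebra_induct [consumes 1, case_names zero basis add smult]:
  assumes f: "f \<in> carrier (basis_algebra R S m U)"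
    and zero: "P \<zero>\<^bsub>basis_algebra R S m U\<^esub>"
    and basis: "\<And>b. b \<in> S \<Longrightarrow> P (basis_elem R b)"
    and add: "\<And>f g. f \<in> carrier (basis_algebra R S m U) \<Longrightarrow> g \<in> carrier (basis_algebra R S m U) \<Longrightarrow>
      P f \<Longrightarrow> P g \<Longrightarrow> P (f \<oplus>\<^bsub>basis_algebra R S m U\<^esub> g)"
    and smult: "\<And>k f. k \<in> carrier R \<Longrightarrow> f \<in> carrier (basis_algebra R S m U) \<Longrightarrow>
      P f \<Longrightarrow> P (k \<odot>\<^bsub>basis_algebra R S m U\<^esub> f)"
  shows "P f"
proof -
  let ?A = "basis_algebra R S m U"
  interpret A: Module.module R ?A by (rule basis_algebra_module)
  have "\<forall>f. f \<in> carrier ?A \<and> {b. f b \<noteq> \<zero>} \<subseteq> X \<longrightarrow> P f" if "finite X" for X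
    using that
  proof (induction X rule: finite_induct)
    case empty
    have "f = \<zero>\<^bsub>?A\<^esub>" if "{b. f b \<noteq> \<zero>} \<subseteq> {}" for f :: "'c \<Rightarrow> 'a"
      using that by (auto simp: fun_eq_iff)
    then show ?case using zero by blast
  next
    case (insert x X)
    show ?case
    proof (intro allI impI)
      fix f assume f: "f \<in> carrier ?A \<and> {b. f b \<noteq> \<zero>} \<subseteq> insert x X"
      show "P f"
      proof (cases "x \<in> S")
        case False
        then have "{b. f b \<noteq> \<zero>} \<subseteq> X"
          using f by (auto simp: basis_algebra_carrier_iff)
        then show ?thesis using f insert.IH by blast
      next
        case True
        \<comment> \<open>Splits off the term at \<open>x\<close>, so that the rest is supported in
          the smaller set \<open>X\<close>.\<close>
        define g where "g = (\<lambda>b. if b = x then \<zero> else f b)"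
        have g: "g \<in> carrier ?A"
          by (rule basis_algebra_carrierI[where X = "{b. f b \<noteq> \<zero>}"])
            (use f in \<open>auto simp: basis_algebra_carrier_iff g_def\<close>)
        moreover have "{b. g b \<noteq> \<zero>} \<subseteq> X"
          using f by (auto simp: g_def)
        ultimately have "P g" using insert.IH by blast
        have fx: "f x \<in> carrier R" using f by (simp add: basis_algebra_carrier_iff)
        have "f = f x \<odot>\<^bsub>?A\<^esub> basis_elem R x \<oplus>\<^bsub>?A\<^esub> g"
          using f by (auto simp: g_def basis_elem_def basis_algebra_carrier_iff)
        moreover have "P (f x \<odot>\<^bsub>?A\<^esub> basis_elem R x \<oplus>\<^bsub>?A\<^esub> g)"
          by (rule add[OF A.smult_closed g smult \<open>P g\<close>]) (use fx True basis in auto)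
        ultimately show ?thesis by simp
      qed
    qed
  qed
  then show ?thesis
    using f by (auto simp: basis_algebra_carrier_iff)
qed

text \<open>The definition sums over exact supports, which change under addition and scaling.
  Padding with zero terms to common finite sets \<open>X\<close> and \<open>Y\<close> makes such
  sums comparable term by term.\<close>

lemma basis_mult_superset:
  assumes f: "f \<in> carrier (basis_algebra R S m U)" and g: "g \<in> carrier (basis_algebra R S m U)"
    and X: "finite X" "{a. f a \<noteq> \<zero>} \<subseteq> X" and Y: "finite Y" "{b. g b \<noteq> \<zero>} \<subseteq> Y"
  shows "(f \<otimes>\<^bsub>basis_algebra R S m U\<^esub> g) c =
    (if c \<in> S then \<Oplus>a\<in>X. \<Oplus>b\<in>Y. (if m a b = c then f a \<otimes> g b else \<zero>) else \<zero>)"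
proof -
  have fc: "f a \<in> carrier R" and gc: "g a \<in> carrier R" for a
    using f g by (auto simp: basis_algebra_carrier_iff)
  have inner: "(\<Oplus>b\<in>{b. g b \<noteq> \<zero>}. (if m a b = c then f a \<otimes> g b else \<zero>)) =
      (\<Oplus>b\<in>Y. (if m a b = c then f a \<otimes> g b else \<zero>))" for a
    by (rule add.finprod_mono_neutral_cong_left) (use Y fc gc in auto)
  have "(\<Oplus>a\<in>{a. f a \<noteq> \<zero>}. \<Oplus>b\<in>Y. (if m a b = c then f a \<otimes> g b else \<zero>)) =
      (\<Oplus>a\<in>X. \<Oplus>b\<in>Y. (if m a b = c then f a \<otimes> g b else \<zero>))"
    by (rule add.finprod_mono_neutral_cong_left)
      (use X fc gc in \<open>auto intro!: finsum_closed add.finprod_one_eqI\<close>)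
  then show ?thesis
    by (simp add: basis_algebra_def inner)
qed

lemma basis_mult_closed:
  assumes f: "f \<in> carrier (basis_algebra R S m U)" and g: "g \<in> carrier (basis_algebra R S m U)"
  shows "f \<otimes>\<^bsub>basis_algebra R S m U\<^esub> g \<in> carrier (basis_algebra R S m U)"
proof -
  let ?X = "{a. f a \<noteq> \<zero>}" and ?Y = "{a. g a \<noteq> \<zero>}"
  have fc: "f a \<in> carrier R" and gc: "g a \<in> carrier R" for a
    using f g by (auto simp: basis_algebra_carrier_iff)
  have fin: "finite ?X" "finite ?Y"
    using f g by (auto simp: basis_algebra_carrier_iff)
  note eq = basis_mult_superset[OF f g fin(1) order.refl fin(2) order.refl]
  show ?thesis
  \<comment> \<open>The support of a product lies among the products of support elements. The
    intersection with \<open>S\<close> discards the values of \<open>m\<close> that stand for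
    zero.\<close>
  proof (rule basis_algebra_carrierI[where X = "S \<inter> (\<lambda>(a, b). m a b) ` (?X \<times> ?Y)"])
    show "(f \<otimes>\<^bsub>basis_algebra R S m U\<^esub> g) c \<in> carrier R" for c
      unfolding eq using fc gc by (auto intro!: finsum_closed)
    show "(f \<otimes>\<^bsub>basis_algebra R S m U\<^esub> g) c = \<zero>"
      if "c \<notin> S \<inter> (\<lambda>(a, b). m a b) ` (?X \<times> ?Y)" for c
      unfolding eq using that by (force intro!: add.finprod_one_eqI)
  qed (use fin in auto)
qed

lemma basis_mult_l_distr:
  fixes S m U defines "A \<equiv> basis_algebra R S m U"
  assumes f: "f \<in> carrier A" and g: "g \<in> carrier A" and h: "h \<in> carrier A"
  shows "(f \<oplus>\<^bsub>A\<^esub> g) \<otimes>\<^bsub>A\<^esub> h = f \<otimes>\<^bsub>A\<^esub> h \<oplus>\<^bsub>A\<^esub> g \<otimes>\<^bsub>A\<^esub> h"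
proof
  fix c
  interpret A: Module.module R A unfolding A_def by (rule basis_algebra_module)
  have C: "f a \<in> carrier R" "g a \<in> carrier R" "h a \<in> carrier R" for a
    using f g h by (auto simp: basis_algebra_carrier_iff A_def)
  define X where "X = {a. f a \<noteq> \<zero>} \<union> {a. g a \<noteq> \<zero>}"
  define Y where "Y = {a. h a \<noteq> \<zero>}"
  have fin: "finite X" "finite Y"
    using f g h by (auto simp: basis_algebra_carrier_iff A_def X_def Y_def)
  have sub: "{a. f a \<noteq> \<zero>} \<subseteq> X" "{a. g a \<noteq> \<zero>} \<subseteq> X" "{a. (f \<oplus>\<^bsub>A\<^esub> g) a \<noteq> \<zero>} \<subseteq> X" "{a. h a \<noteq> \<zero>} \<subseteq> Y"
    by (auto simp: A_def X_def Y_def)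
  note eq = basis_mult_superset[where S = S and m = m and U = U and X = X and Y = Y, folded A_def, OF _ h fin(1) _ fin(2) sub(4)]
  have 1: "((f \<oplus>\<^bsub>A\<^esub> g) \<otimes>\<^bsub>A\<^esub> h) c = (if c \<in> S then \<Oplus>a\<in>X. \<Oplus>b\<in>Y. (if m a b = c then (f a \<oplus> g a) \<otimes> h b else \<zero>) else \<zero>)"
    unfolding eq[OF A.a_closed[OF f g] sub(3)] by (simp add: A_def cong: if_cong)
  have "(\<Oplus>a\<in>X. \<Oplus>b\<in>Y. (if m a b = c then (f a \<oplus> g a) \<otimes> h b else \<zero>)) =
      (\<Oplus>a\<in>X. (\<Oplus>b\<in>Y. (if m a b = c then f a \<otimes> h b else \<zero>)) \<oplus> (\<Oplus>b\<in>Y. (if m a b = c then g a \<otimes> h b else \<zero>)))"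
    by (intro finsum_cong', simp)
      (auto simp: C l_distr simp flip: finsum_addf intro!: finsum_cong' finsum_closed)
  also have "\<dots> = (\<Oplus>a\<in>X. (\<Oplus>b\<in>Y. (if m a b = c then f a \<otimes> h b else \<zero>))) \<oplus> (\<Oplus>a\<in>X. (\<Oplus>b\<in>Y. (if m a b = c then g a \<otimes> h b else \<zero>)))"
    by (intro finsum_addf) (auto simp: C intro!: finsum_closed)
  finally have "((f \<oplus>\<^bsub>A\<^esub> g) \<otimes>\<^bsub>A\<^esub> h) c = (f \<otimes>\<^bsub>A\<^esub> h) c \<oplus> (g \<otimes>\<^bsub>A\<^esub> h) c"
    unfolding 1 eq[OF f sub(1)] eq[OF g sub(2)] by simp
  then show "((f \<oplus>\<^bsub>A\<^esub> g) \<otimes>\<^bsub>A\<^esub> h) c = (f \<otimes>\<^bsub>A\<^esub> h \<oplus>\<^bsub>A\<^esub> g \<otimes>\<^bsub>A\<^esub> h) c"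
    by (simp add: A_def)
qed

lemma basis_mult_r_distr:
  fixes S m U defines "A \<equiv> basis_algebra R S m U"
  assumes f: "f \<in> carrier A" and g: "g \<in> carrier A" and h: "h \<in> carrier A"
  shows "h \<otimes>\<^bsub>A\<^esub> (f \<oplus>\<^bsub>A\<^esub> g) = h \<otimes>\<^bsub>A\<^esub> f \<oplus>\<^bsub>A\<^esub> h \<otimes>\<^bsub>A\<^esub> g"
proof
  fix c
  interpret A: Module.module R A unfolding A_def by (rule basis_algebra_module)
  have C: "f a \<in> carrier R" "g a \<in> carrier R" "h a \<in> carrier R" for a
    using f g h by (auto simp: basis_algebra_carrier_iff A_def)
  define X where "X = {a. f a \<noteq> \<zero>} \<union> {a. g a \<noteq> \<zero>}"
  define Y where "Y = {a. h a \<noteq> \<zero>}"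
  have fin: "finite X" "finite Y"
    using f g h by (auto simp: basis_algebra_carrier_iff A_def X_def Y_def)
  have sub: "{a. f a \<noteq> \<zero>} \<subseteq> X" "{a. g a \<noteq> \<zero>} \<subseteq> X" "{a. (f \<oplus>\<^bsub>A\<^esub> g) a \<noteq> \<zero>} \<subseteq> X" "{a. h a \<noteq> \<zero>} \<subseteq> Y"
    by (auto simp: A_def X_def Y_def)
  note eq = basis_mult_superset[where S = S and m = m and U = U and X = Y and Y = X, folded A_def, OF h _ fin(2) sub(4) fin(1)]
  have 1: "(h \<otimes>\<^bsub>A\<^esub> (f \<oplus>\<^bsub>A\<^esub> g)) c = (if c \<in> S then \<Oplus>a\<in>Y. \<Oplus>b\<in>X. (if m a b = c then h a \<otimes> (f b \<oplus> g b) else \<zero>) else \<zero>)"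
    unfolding eq[OF A.a_closed[OF f g] sub(3)] by (simp add: A_def cong: if_cong)
  have "(\<Oplus>a\<in>Y. \<Oplus>b\<in>X. (if m a b = c then h a \<otimes> (f b \<oplus> g b) else \<zero>)) =
      (\<Oplus>a\<in>Y. (\<Oplus>b\<in>X. (if m a b = c then h a \<otimes> f b else \<zero>)) \<oplus> (\<Oplus>b\<in>X. (if m a b = c then h a \<otimes> g b else \<zero>)))"
    by (intro finsum_cong', simp)
      (auto simp: C r_distr simp flip: finsum_addf intro!: finsum_cong' finsum_closed)
  also have "\<dots> = (\<Oplus>a\<in>Y. (\<Oplus>b\<in>X. (if m a b = c then h a \<otimes> f b else \<zero>))) \<oplus> (\<Oplus>a\<in>Y. (\<Oplus>b\<in>X. (if m a b = c then h a \<otimes> g b else \<zero>)))"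
    by (intro finsum_addf) (auto simp: C intro!: finsum_closed)
  finally have "(h \<otimes>\<^bsub>A\<^esub> (f \<oplus>\<^bsub>A\<^esub> g)) c = (h \<otimes>\<^bsub>A\<^esub> f) c \<oplus> (h \<otimes>\<^bsub>A\<^esub> g) c"
    unfolding 1 eq[OF f sub(1)] eq[OF g sub(2)] by simp
  then show "(h \<otimes>\<^bsub>A\<^esub> (f \<oplus>\<^bsub>A\<^esub> g)) c = (h \<otimes>\<^bsub>A\<^esub> f \<oplus>\<^bsub>A\<^esub> h \<otimes>\<^bsub>A\<^esub> g) c"
    by (simp add: A_def)
qed

lemma basis_mult_smult:
  fixes S m U defines "A \<equiv> basis_algebra R S m U"
  assumes k: "k \<in> carrier R" and f: "f \<in> carrier A" and g: "g \<in> carrier A"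
  shows "(k \<odot>\<^bsub>A\<^esub> f) \<otimes>\<^bsub>A\<^esub> g = k \<odot>\<^bsub>A\<^esub> (f \<otimes>\<^bsub>A\<^esub> g)"
    and "f \<otimes>\<^bsub>A\<^esub> (k \<odot>\<^bsub>A\<^esub> g) = k \<odot>\<^bsub>A\<^esub> (f \<otimes>\<^bsub>A\<^esub> g)"
proof -
  interpret A: Module.module R A unfolding A_def by (rule basis_algebra_module)
  have C: "f a \<in> carrier R" "g a \<in> carrier R" for a
    using f g by (auto simp: basis_algebra_carrier_iff A_def)
  define X where "X = {a. f a \<noteq> \<zero>}"
  define Y where "Y = {a. g a \<noteq> \<zero>}"
  have fin: "finite X" "finite Y"
    using f g by (auto simp: basis_algebra_carrier_iff A_def X_def Y_def)
  have sub: "{a. f a \<noteq> \<zero>} \<subseteq> X" "{a. g a \<noteq> \<zero>} \<subseteq> Y"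
    "{a. (k \<odot>\<^bsub>A\<^esub> f) a \<noteq> \<zero>} \<subseteq> X" "{a. (k \<odot>\<^bsub>A\<^esub> g) a \<noteq> \<zero>} \<subseteq> Y"
    using k by (auto simp: A_def X_def Y_def)
  note eq = basis_mult_superset[where S = S and m = m and U = U and X = X and Y = Y, folded A_def, OF _ _ fin(1) _ fin(2)]
  have *: "k \<otimes> (\<Oplus>a\<in>X. \<Oplus>b\<in>Y. (if m a b = c then f a \<otimes> g b else \<zero>)) =
      (\<Oplus>a\<in>X. \<Oplus>b\<in>Y. (if m a b = c then k \<otimes> (f a \<otimes> g b) else \<zero>))" for c
    using fin k
    by (auto simp: C finsum_rdistr intro!: finsum_cong' finsum_closed)
  show "(k \<odot>\<^bsub>A\<^esub> f) \<otimes>\<^bsub>A\<^esub> g = k \<odot>\<^bsub>A\<^esub> (f \<otimes>\<^bsub>A\<^esub> g)"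
  proof
    fix c
    have "((k \<odot>\<^bsub>A\<^esub> f) \<otimes>\<^bsub>A\<^esub> g) c = (if c \<in> S then \<Oplus>a\<in>X. \<Oplus>b\<in>Y. (if m a b = c then k \<otimes> (f a \<otimes> g b) else \<zero>) else \<zero>)"
      unfolding eq[OF A.smult_closed[OF k f] g sub(3,2)] using k C by (simp add: A_def m_assoc cong: if_cong)
    then show "((k \<odot>\<^bsub>A\<^esub> f) \<otimes>\<^bsub>A\<^esub> g) c = (k \<odot>\<^bsub>A\<^esub> (f \<otimes>\<^bsub>A\<^esub> g)) c"
      using k by (simp add: * [symmetric] A_def eq[OF f g sub(1,2), unfolded A_def])
  qed
  show "f \<otimes>\<^bsub>A\<^esub> (k \<odot>\<^bsub>A\<^esub> g) = k \<odot>\<^bsub>A\<^esub> (f \<otimes>\<^bsub>A\<^esub> g)"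
  proof
    fix c
    have "(f \<otimes>\<^bsub>A\<^esub> (k \<odot>\<^bsub>A\<^esub> g)) c = (if c \<in> S then \<Oplus>a\<in>X. \<Oplus>b\<in>Y. (if m a b = c then k \<otimes> (f a \<otimes> g b) else \<zero>) else \<zero>)"
      unfolding eq[OF f A.smult_closed[OF k g] sub(1,4)] using k C by (simp add: A_def m_lcomm cong: if_cong)
    then show "(f \<otimes>\<^bsub>A\<^esub> (k \<odot>\<^bsub>A\<^esub> g)) c = (k \<odot>\<^bsub>A\<^esub> (f \<otimes>\<^bsub>A\<^esub> g)) c"
      using k by (simp add: * [symmetric] A_def eq[OF f g sub(1,2), unfolded A_def])
  qed
qed

lemma basis_mult_basis_elem:
  assumes "a \<in> S" "b \<in> S"
  shows "basis_elem R a \<otimes>\<^bsub>basis_algebra R S m U\<^esub> basis_elem R b =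
    (if m a b \<in> S then basis_elem R (m a b) else \<zero>\<^bsub>basis_algebra R S m U\<^esub>)"
proof
  fix c
  have s: "{x. basis_elem R y x \<noteq> \<zero>} \<subseteq> {y}" for y :: 'c
    by (auto simp: basis_elem_def)
  show "(basis_elem R a \<otimes>\<^bsub>basis_algebra R S m U\<^esub> basis_elem R b) c =
    (if m a b \<in> S then basis_elem R (m a b) else \<zero>\<^bsub>basis_algebra R S m U\<^esub>) c"
    unfolding basis_mult_superset[OF basis_elem_closed[OF assms(1)] basis_elem_closed[OF assms(2)]
        _ s[of a] _ s[of b], simplified]
    by (auto simp: basis_elem_def)
qed

text \<open>Exactly one summand of the unit composes with \<open>a\<close>. In the groupoid algebra
  this is the constant path at the end of the path \<open>a\<close>.\<close>

lemma basis_mult_one_right: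
  assumes "finite U" "U \<subseteq> S" "a \<in> S"
    and u: "u \<in> U" "m a u = a" "\<And>v. v \<in> U \<Longrightarrow> v \<noteq> u \<Longrightarrow> m a v \<notin> S"
  shows "basis_elem R a \<otimes>\<^bsub>basis_algebra R S m U\<^esub> \<one>\<^bsub>basis_algebra R S m U\<^esub> = basis_elem R a"
proof -
  let ?A = "basis_algebra R S m U"
  have one: "\<one>\<^bsub>?A\<^esub> \<in> carrier ?A"
    by (rule basis_algebra_carrierI[of _ U]) (use assms in auto)
  have s: "{x. basis_elem R y x \<noteq> \<zero>} \<subseteq> {y}" for y :: 'c
    by (auto simp: basis_elem_def)
  have fin: "finite {a}" by simp
  have o: "{x. \<one>\<^bsub>?A\<^esub> x \<noteq> \<zero>} \<subseteq> U"
    by auto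
  show "basis_elem R a \<otimes>\<^bsub>?A\<^esub> \<one>\<^bsub>?A\<^esub> = basis_elem R a"
  proof
    fix c
    have eq: "m a v = a \<longleftrightarrow> u = v" if "v \<in> U" for v
      using u that \<open>a \<in> S\<close> by metis
    have neq: "m a v \<noteq> c" if "v \<in> U" "u \<noteq> v" "c \<in> S" for v
      using u that by metis
    have "(\<Oplus>b\<in>U. if m a b = c then if b \<in> U then \<one> else \<zero> else \<zero>) = (\<Oplus>b\<in>U. if u = b then basis_elem R a c else \<zero>)" if "c \<in> S"
      by (rule finsum_cong') (use u(1,2) eq neq that in \<open>auto simp: basis_elem_def\<close>)
    also have "\<dots> = basis_elem R a c"
      using finsum_singleton[OF u(1) assms(1), of "\<lambda>_. basis_elem R a c"] by (simp add: basis_elem_def)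
    finally show "(basis_elem R a \<otimes>\<^bsub>?A\<^esub> \<one>\<^bsub>?A\<^esub>) c = basis_elem R a c"
      using assms
      unfolding basis_mult_superset[OF basis_elem_closed[OF assms(3)] one fin s[of a] assms(1) o]
      by (auto simp: basis_elem_def cong: if_cong)
  qed
qed

end

section \<open>Linear extension from a basis to a module\<close>

definition lin_ext ::
    "('k, 'm) ring_scheme \<Rightarrow> ('k, 'a, 'p) module_scheme \<Rightarrow> ('b \<Rightarrow> 'a) \<Rightarrow> ('b \<Rightarrow> 'k) \<Rightarrow> 'a"
  where "lin_ext K M g f = (\<Oplus>\<^bsub>M\<^esub>b\<in>{b. f b \<noteq> \<zero>\<^bsub>K\<^esub>}. f b \<odot>\<^bsub>M\<^esub> g b)"

context Module.module
begin

lemma lin_ext_superset: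
  assumes "f \<in> carrier (basis_algebra R S m U)" "g \<in> S \<rightarrow> carrier M"
    "finite X" "{b. f b \<noteq> \<zero>} \<subseteq> X" "X \<subseteq> S"
  shows "lin_ext R M g f = (\<Oplus>\<^bsub>M\<^esub>b\<in>X. f b \<odot>\<^bsub>M\<^esub> g b)"
  unfolding lin_ext_def
  by (rule M.add.finprod_mono_neutral_cong_left)
    (use assms in \<open>auto simp: basis_algebra_carrier_iff Pi_iff subset_iff\<close>)

lemma lin_ext_closed:
  assumes "f \<in> carrier (basis_algebra R S m U)" "g \<in> S \<rightarrow> carrier M"
  shows "lin_ext R M g f \<in> carrier M"
  unfolding lin_ext_def using assms
  by (intro M.finsum_closed) (force simp: basis_algebra_carrier_iff Pi_iff)

lemma lin_ext_add:
  assumes f: "f \<in> carrier (basis_algebra R S m U)" and f': "f' \<in> carrier (basis_algebra R S m U)"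
    and g: "g \<in> S \<rightarrow> carrier M"
  shows "lin_ext R M g (f \<oplus>\<^bsub>basis_algebra R S m U\<^esub> f') = lin_ext R M g f \<oplus>\<^bsub>M\<^esub> lin_ext R M g f'"
proof -
  interpret A: Module.module R "basis_algebra R S m U" by (rule basis_algebra_module)
  define X where "X = {a. f a \<noteq> \<zero>} \<union> {a. f' a \<noteq> \<zero>}"
  have X: "finite X" "X \<subseteq> S" and C: "f a \<in> carrier R" "f' a \<in> carrier R" for a
    using f f' by (auto simp: X_def basis_algebra_carrier_iff)
  have sub: "{b. f b \<noteq> \<zero>} \<subseteq> X" "{b. f' b \<noteq> \<zero>} \<subseteq> X"
    "{b. (f \<oplus>\<^bsub>basis_algebra R S m U\<^esub> f') b \<noteq> \<zero>} \<subseteq> X"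
    by (auto simp: X_def)
  note eq = lin_ext_superset[where m = m and U = U, OF _ g X(1) _ X(2)]
  have gX: "g b \<in> carrier M" if "b \<in> X" for b using g X(2) that by auto
  have "(\<Oplus>\<^bsub>M\<^esub>b\<in>X. (f b \<oplus> f' b) \<odot>\<^bsub>M\<^esub> g b) =
      (\<Oplus>\<^bsub>M\<^esub>b\<in>X. f b \<odot>\<^bsub>M\<^esub> g b \<oplus>\<^bsub>M\<^esub> f' b \<odot>\<^bsub>M\<^esub> g b)"
    by (rule M.finsum_cong') (use C gX in \<open>auto simp: smult_l_distr\<close>)
  then show ?thesis
    using C gX by (simp add: eq[OF f sub(1)] eq[OF f' sub(2)] eq[OF A.a_closed[OF f f'] sub(3), simplified] M.finsum_addf)
qed

lemma lin_ext_smult: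
  assumes k: "k \<in> carrier R" and f: "f \<in> carrier (basis_algebra R S m U)"
    and g: "g \<in> S \<rightarrow> carrier M"
  shows "lin_ext R M g (k \<odot>\<^bsub>basis_algebra R S m U\<^esub> f) = k \<odot>\<^bsub>M\<^esub> lin_ext R M g f"
proof -
  interpret A: Module.module R "basis_algebra R S m U" by (rule basis_algebra_module)
  define X where "X = {a. f a \<noteq> \<zero>}"
  have X: "finite X" "X \<subseteq> S" and C: "f a \<in> carrier R" for a
    using f by (auto simp: X_def basis_algebra_carrier_iff)
  have sub: "{b. f b \<noteq> \<zero>} \<subseteq> X" "{b. (k \<odot>\<^bsub>basis_algebra R S m U\<^esub> f) b \<noteq> \<zero>} \<subseteq> X"
    using k by (auto simp: X_def)
  note eq = lin_ext_superset[where m = m and U = U, OF _ g X(1) _ X(2)]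
  have gX: "g b \<in> carrier M" if "b \<in> X" for b using g X(2) that by auto
  have "(\<Oplus>\<^bsub>M\<^esub>b\<in>X. (k \<otimes> f b) \<odot>\<^bsub>M\<^esub> g b) = (\<Oplus>\<^bsub>M\<^esub>b\<in>X. k \<odot>\<^bsub>M\<^esub> (f b \<odot>\<^bsub>M\<^esub> g b))"
    by (rule M.finsum_cong') (use C gX k in \<open>auto simp: smult_assoc1\<close>)
  also have "\<dots> = k \<odot>\<^bsub>M\<^esub> (\<Oplus>\<^bsub>M\<^esub>b\<in>X. f b \<odot>\<^bsub>M\<^esub> g b)"
    by (rule finsum_smult_ldistr[symmetric]) (use C gX k X in auto)
  finally show ?thesis
    using C gX k by (simp add: eq[OF f sub(1)] eq[OF A.smult_closed[OF k f] sub(2), simplified])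
qed

lemma lin_ext_basis_elem:
  assumes "b \<in> S" "g \<in> S \<rightarrow> carrier M"
  shows "lin_ext R M g (basis_elem R b) = g b"
proof -
  have "lin_ext R M g (basis_elem R b) = (\<Oplus>\<^bsub>M\<^esub>c\<in>{b}. basis_elem R b c \<odot>\<^bsub>M\<^esub> g c)"
    by (rule lin_ext_superset[OF basis_elem_closed]) (use assms in \<open>auto simp: basis_elem_def\<close>)
  also have "\<dots> = g b" using assms by (auto simp: basis_elem_def Pi_iff)
  finally show ?thesis .
qed

lemma lin_ext_zero: "lin_ext R M g \<zero>\<^bsub>basis_algebra R S m U\<^esub> = \<zero>\<^bsub>M\<^esub>"
  by (simp add: lin_ext_def)

end

declare basis_algebra_simps [simp del]

context cring
begin

lemma basis_mult_zero:
  assumes f: "f \<in> carrier (basis_algebra R S m U)"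
  shows "\<zero>\<^bsub>basis_algebra R S m U\<^esub> \<otimes>\<^bsub>basis_algebra R S m U\<^esub> f = \<zero>\<^bsub>basis_algebra R S m U\<^esub>"
    and "f \<otimes>\<^bsub>basis_algebra R S m U\<^esub> \<zero>\<^bsub>basis_algebra R S m U\<^esub> = \<zero>\<^bsub>basis_algebra R S m U\<^esub>"
proof -
  interpret A: Module.module R "basis_algebra R S m U" by (rule basis_algebra_module)
  show "\<zero>\<^bsub>basis_algebra R S m U\<^esub> \<otimes>\<^bsub>basis_algebra R S m U\<^esub> f = \<zero>\<^bsub>basis_algebra R S m U\<^esub>"
    using basis_mult_smult(1)[OF zero_closed A.zero_closed f] basis_mult_closed[OF A.zero_closed f] by simp
  show "f \<otimes>\<^bsub>basis_algebra R S m U\<^esub> \<zero>\<^bsub>basis_algebra R S m U\<^esub> = \<zero>\<^bsub>basis_algebra R S m U\<^esub>"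
    using basis_mult_smult(2)[OF zero_closed f A.zero_closed] basis_mult_closed[OF f A.zero_closed] by simp
qed

lemma basis_mult_finsum:
  fixes S m U defines "A \<equiv> basis_algebra R S m U"
  assumes X: "finite X" "F \<in> X \<rightarrow> carrier A" and f: "f \<in> carrier A"
  shows "(\<Oplus>\<^bsub>A\<^esub>x\<in>X. F x) \<otimes>\<^bsub>A\<^esub> f = (\<Oplus>\<^bsub>A\<^esub>x\<in>X. F x \<otimes>\<^bsub>A\<^esub> f)"
    and "f \<otimes>\<^bsub>A\<^esub> (\<Oplus>\<^bsub>A\<^esub>x\<in>X. F x) = (\<Oplus>\<^bsub>A\<^esub>x\<in>X. f \<otimes>\<^bsub>A\<^esub> F x)"
proof -
  interpret A: Module.module R A unfolding A_def by (rule basis_algebra_module)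
  note closed = basis_mult_closed[where S = S and m = m and U = U, folded A_def]
  note rules = basis_mult_l_distr[where S = S and m = m and U = U, folded A_def]
    basis_mult_r_distr[where S = S and m = m and U = U, folded A_def]
    basis_mult_zero[where S = S and m = m and U = U, folded A_def] closed
  show "(\<Oplus>\<^bsub>A\<^esub>x\<in>X. F x) \<otimes>\<^bsub>A\<^esub> f = (\<Oplus>\<^bsub>A\<^esub>x\<in>X. F x \<otimes>\<^bsub>A\<^esub> f)"
    using X by (induction X rule: finite_induct) (auto simp: rules f Pi_iff A.finsum_closed A.finsum_insert)
  show "f \<otimes>\<^bsub>A\<^esub> (\<Oplus>\<^bsub>A\<^esub>x\<in>X. F x) = (\<Oplus>\<^bsub>A\<^esub>x\<in>X. f \<otimes>\<^bsub>A\<^esub> F x)"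
    using X by (induction X rule: finite_induct) (auto simp: rules f Pi_iff A.finsum_closed A.finsum_insert)
qed

text \<open>The hypotheses make \<open>S\<close> a monoid under \<open>m\<close>, so this is the
  monoid algebra. Both sides of associativity are trilinear, and three nested inductions reduce it
  to associativity of \<open>m\<close> on basis elements. It is applied to words under
  concatenation.\<close>

lemma basis_algebra_ring:
  fixes S m u defines "A \<equiv> basis_algebra R S m {u}"
  assumes closed: "\<And>a b. a \<in> S \<Longrightarrow> b \<in> S \<Longrightarrow> m a b \<in> S"
    and assoc: "\<And>a b c. a \<in> S \<Longrightarrow> b \<in> S \<Longrightarrow> c \<in> S \<Longrightarrow> m (m a b) c = m a (m b c)"
    and unit: "u \<in> S" "\<And>a. a \<in> S \<Longrightarrow> m u a = a" "\<And>a. a \<in> S \<Longrightarrow> m a u = a"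
  shows "ring A"
proof -
  interpret A: Module.module R A unfolding A_def by (rule basis_algebra_module)
  note mclosed [simp] = basis_mult_closed[where S = S and m = m and U = "{u}", folded A_def]
  note distr = basis_mult_l_distr[where S = S and m = m and U = "{u}", folded A_def]
    basis_mult_r_distr[where S = S and m = m and U = "{u}", folded A_def]
  note rules [simp] = distr basis_mult_zero[where S = S and m = m and U = "{u}", folded A_def]
    basis_mult_smult[where S = S and m = m and U = "{u}", folded A_def]
  note induct = basis_algebra_induct[where S = S and m = m and U = "{u}", folded A_def, consumes 1, case_names zero basis add smult]
  have be [simp]: "basis_elem R b \<in> carrier A" if "b \<in> S" for b
    unfolding A_def by (rule basis_elem_closed[OF that])
  have mult_be [simp]: "basis_elem R a \<otimes>\<^bsub>A\<^esub> basis_elem R b = basis_elem R (m a b)" if "a \<in> S" "b \<in> S" for a b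
    using basis_mult_basis_elem[OF that] closed[OF that] by (simp add: A_def)
  have one_eq: "\<one>\<^bsub>A\<^esub> = basis_elem R u"
    by (auto simp: A_def basis_elem_def basis_algebra_simps)
  have "f \<otimes>\<^bsub>A\<^esub> g \<otimes>\<^bsub>A\<^esub> h = f \<otimes>\<^bsub>A\<^esub> (g \<otimes>\<^bsub>A\<^esub> h)"
    if f: "f \<in> carrier A" and g: "g \<in> carrier A" and h: "h \<in> carrier A" for f g h
    using f
  proof (induction rule: induct)
    case (basis a)
    show ?case using g
    proof (induction rule: induct)
      case (basis b)
      show ?case using h
        by (induction rule: induct) (use \<open>a \<in> S\<close> \<open>b \<in> S\<close> in \<open>simp_all add: closed assoc\<close>)
    qed (use basis h in simp_all)
  qed (use g h in simp_all)
  moreover have "\<one>\<^bsub>A\<^esub> \<otimes>\<^bsub>A\<^esub> f = f" "f \<otimes>\<^bsub>A\<^esub> \<one>\<^bsub>A\<^esub> = f" if "f \<in> carrier A" for f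
    using that unfolding one_eq by (induction rule: induct) (use unit in simp_all)
  ultimately show ?thesis
    by (intro ringI monoidI A.abelian_group_axioms distr) (simp_all add: one_eq unit)
qed

end

section \<open>Homotopy of paths\<close>

context pair_graph
begin

text \<open>Replaces the list of arcs in \<open>vwalk\<close> by \<open>successively\<close>, which
  splits directly over appended lists.\<close>

lemma vwalk_iff_successively:
  "vwalk p (with_proj G) \<longleftrightarrow>
    p \<noteq> [] \<and> set p \<subseteq> pverts G \<and> successively (\<lambda>a b. (a, b) \<in> parcs G) p"
proof -
  have "set (vwalk_arcs p) \<subseteq> parcs G \<longleftrightarrow> successively (\<lambda>a b. (a, b) \<in> parcs G) p"
    by (induction p rule: vwalk_arcs.induct) auto
  then show ?thesis
    by (auto simp: vwalk_def)
qed

lemma vwalk_hd_last: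
  assumes "vwalk p (with_proj G)"
  shows "hd p \<in> pverts G" "last p \<in> pverts G" "p \<noteq> []"
  using assms by (auto simp: vwalk_iff_successively)

lemma vwalk_append_tl:
  assumes "vwalk p (with_proj G)" "vwalk q (with_proj G)" "last p = hd q"
  shows "vwalk (p @ tl q) (with_proj G)"
  using assms by (cases q) (auto simp: vwalk_iff_successively successively_append_iff successively_Cons)

lemma append_tl_eq_butlast_append:
  assumes "p \<noteq> []" "q \<noteq> []" "last p = hd q"
  shows "p @ tl q = butlast p @ q"
  using assms by (cases p rule: rev_cases; cases q) auto

text \<open>A backtracking keeps its base vertex \<open>a\<close>, so the endpoints survive even
  when it stands at the beginning or the end of the path.\<close>

lemma homotopic_pathsD:
  assumes "homotopic_paths G p q"
  shows "vwalk p (with_proj G) \<and> vwalk q (with_proj G) \<and> hd p = hd q \<and> last p = last q"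
  using assms
proof induction
  case (backtrack p a b q)
  then show ?case
    by (auto simp: vwalk_iff_successively successively_append_iff successively_Cons hd_append)
qed auto

lemma homotopic_paths_append_tl_left:
  assumes "homotopic_paths G p p'" "vwalk q (with_proj G)" "last p = hd q"
  shows "homotopic_paths G (p @ tl q) (p' @ tl q)"
  using assms
proof induction
  case (backtrack p a b r)
  then show ?case
    using homotopic_paths.backtrack[of p a b "r @ tl q" G]
      vwalk_append_tl[OF backtrack.hyps backtrack.prems] by simp
next
  case (refl p)
  then show ?case by (intro homotopic_paths.refl vwalk_append_tl)
next
  case (sym x y)
  then show ?case using homotopic_pathsD[OF sym.hyps] by (auto intro: homotopic_paths.sym)
next
  case (trans x y z)
  then show ?case using homotopic_pathsD[OF trans.hyps(1)] by (auto intro: homotopic_paths.trans)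
qed

lemma homotopic_paths_append_tl_right:
  assumes "homotopic_paths G q q'" "vwalk p (with_proj G)" "last p = hd q"
  shows "homotopic_paths G (p @ tl q) (p @ tl q')"
proof -
  \<comment> \<open>In the form \<open>butlast p @ q\<close> the second path stands whole, so a
    backtracking at its very start is still a block \<open>[a, b, a]\<close>. In
    \<open>p @ tl q\<close> its first letter would be hidden inside \<open>p\<close>.\<close>
  have "homotopic_paths G (butlast p @ q) (butlast p @ q')"
    using assms
  proof induction
    case (refl q)
    then show ?case
      using vwalk_append_tl[of p q] append_tl_eq_butlast_append[of p q]
      by (auto intro: homotopic_paths.refl simp: vwalk_def)
  next
    case (backtrack x a b r)
    have "vwalk (butlast p @ x @ [a, b, a] @ r) (with_proj G)"
      using vwalk_append_tl[OF backtrack.prems(1) backtrack.hyps backtrack.prems(2)]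
        append_tl_eq_butlast_append[OF vwalk_hd_last(3)[OF backtrack.prems(1)]
          vwalk_hd_last(3)[OF backtrack.hyps] backtrack.prems(2)]
      by simp
    then show ?case
      using homotopic_paths.backtrack[of "butlast p @ x" a b r G] by simp
  next
    case (sym x y)
    then show ?case using homotopic_pathsD[OF sym.hyps] by (auto intro: homotopic_paths.sym)
  next
    case (trans x y z)
    then show ?case using homotopic_pathsD[OF trans.hyps(1)] by (auto intro: homotopic_paths.trans)
  qed
  moreover have "p @ tl q = butlast p @ q" "p @ tl q' = butlast p @ q'"
    using assms homotopic_pathsD[OF assms(1)]
    by (auto intro!: append_tl_eq_butlast_append simp: vwalk_def)
  ultimately show ?thesis by simp
qed

lemma homotopy_class_eq_iff:
  assumes "vwalk p (with_proj G)"
  shows "homotopy_class G p = homotopy_class G q \<longleftrightarrow> homotopic_paths G p q"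
proof
  assume "homotopy_class G p = homotopy_class G q"
  then have "homotopic_paths G q p"
    using homotopic_paths.refl[OF assms] by (auto simp: homotopy_class_def)
  then show "homotopic_paths G p q" by (rule homotopic_paths.sym)
next
  assume "homotopic_paths G p q"
  then show "homotopy_class G p = homotopy_class G q"
    by (auto simp: homotopy_class_def intro: homotopic_paths.sym homotopic_paths.trans)
qed

lemma homotopy_class_in_classes [simp]:
  "vwalk p (with_proj G) \<Longrightarrow> homotopy_class G p \<in> homotopy_classes G"
  by (auto simp: homotopy_classes_def)

text \<open>The empty set is the value of \<open>concat_classes\<close> on classes that cannot be
  composed; lying outside the basis, it makes their product zero.\<close>

lemma empty_notin_homotopy_classes [simp]: "{} \<notin> homotopy_classes G"
  by (auto simp: homotopy_classes_def homotopy_class_def dest: homotopic_paths.refl)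

text \<open>Concatenation is well defined on classes: the union over all pairs of representatives is
  a union of copies of a single class, and the endpoint test has the same outcome for every
  pair.\<close>

lemma concat_homotopy_class:
  assumes p: "vwalk p (with_proj G)" and q: "vwalk q (with_proj G)"
  shows "concat_classes G (homotopy_class G p) (homotopy_class G q) =
    (if last p = hd q then homotopy_class G (p @ tl q) else {})"
proof (cases "last p = hd q")
  case True
  have "homotopy_class G (vwalk_join p' q') = homotopy_class G (p @ tl q) \<and> last p' = hd q'"
    if "p' \<in> homotopy_class G p" "q' \<in> homotopy_class G q" for p' q'
  proof -
    have h: "homotopic_paths G p p'" "homotopic_paths G q q'"
      using that by (auto simp: homotopy_class_def)
    then have e: "last p' = hd q'" "last p' = hd q" "vwalk p' (with_proj G)"
      using homotopic_pathsD True by metis+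
    have "homotopic_paths G (p @ tl q) (p' @ tl q')"
      by (rule homotopic_paths.trans[OF homotopic_paths_append_tl_left[OF h(1) q True]
            homotopic_paths_append_tl_right[OF h(2) e(3,2)]])
    then have "homotopy_class G (p @ tl q) = homotopy_class G (p' @ tl q')"
      using homotopy_class_eq_iff[OF vwalk_append_tl[OF p q True]] by blast
    then show ?thesis
      using e by (simp add: vwalk_join_def)
  qed
  moreover have "p \<in> homotopy_class G p" "q \<in> homotopy_class G q"
    using p q by (auto simp: homotopy_class_def intro: homotopic_paths.refl)
  ultimately show ?thesis
    using True unfolding concat_classes_def by (simp, blast)
next
  case False
  have "last p' \<noteq> hd q'"
    if "p' \<in> homotopy_class G p" "q' \<in> homotopy_class G q" for p' q'
    using that False homotopic_pathsD by (metis homotopy_class_def mem_Collect_eq)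
  then show ?thesis
    using False by (auto simp: concat_classes_def)
qed

end

section \<open>Words in the homotope\<close>

locale edge_weighted_graph = cring K + pair_graph G
  for K :: "('k, 'm) ring_scheme" (structure) and G :: "'v pair_pre_digraph" +
  fixes s :: "'v \<Rightarrow> 'v \<Rightarrow> 'k"
  assumes weight_Units: "(i, j) \<in> parcs G \<Longrightarrow> s i j \<in> Units K"
    and weight_sym: "(i, j) \<in> parcs G \<Longrightarrow> s i j = s j i"
begin

abbreviation "A \<equiv> groupoid_algebra K G"
abbreviation "D \<equiv> laplace K G s"
abbreviation "cls \<equiv> homotopy_class G"

lemma weight_closed [simp]: "(i, j) \<in> parcs G \<Longrightarrow> s i j \<in> carrier K"
  using weight_Units by (auto simp: Units_def)

lemma irreflexive_arcs [simp]: "(i, i) \<notin> parcs G"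
  using no_loops by fastforce

lemma arc_in_verts [simp]:
  assumes "(i, j) \<in> parcs G"
  shows "i \<in> pverts G" "j \<in> pverts G"
  using wellformed[OF assms] by simp_all

text \<open>
  As \<open>x\<^sub>i\<^sup>2 = x\<^sub>i\<close>, a letter of a word may be repeated: the repetition has weight \<open>1\<close> and disappears
  from the path, which \<^const>\<open>remdups_adj\<close> expresses.
\<close>

definition lazy_walk :: "'v list \<Rightarrow> bool"
  where "lazy_walk w \<longleftrightarrow>
    w \<noteq> [] \<and> set w \<subseteq> pverts G \<and> successively (\<lambda>a b. a = b \<or> (a, b) \<in> parcs G) w"

fun walk_weight :: "'v list \<Rightarrow> 'k" where
  "walk_weight (a # b # w) = (if a = b then \<one> else s a b) \<otimes> walk_weight (b # w)"
| "walk_weight w = \<one>"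

text \<open>Closed form of the product of the vertices of \<open>w\<close> in the homotope. The
  empty word is not a lazy walk and gets zero; its coefficient is recorded separately in
  \<open>unital_walk_map\<close>.\<close>

definition walk_elem :: "'v list \<Rightarrow> 'v list set \<Rightarrow> 'k"
  where "walk_elem w =
    (if lazy_walk w then walk_weight w \<odot>\<^bsub>A\<^esub> basis_elem K (cls (remdups_adj w)) else \<zero>\<^bsub>A\<^esub>)"

lemma lazy_walk_append_iff:
  assumes "v \<noteq> []" "w \<noteq> []"
  shows "lazy_walk (v @ w) \<longleftrightarrow>
    lazy_walk v \<and> lazy_walk w \<and> (last v = hd w \<or> (last v, hd w) \<in> parcs G)"
  using assms by (auto simp: lazy_walk_def successively_append_iff)

lemma lazy_walk_ConsCons:
  "lazy_walk (a # b # w) \<longleftrightarrow> a \<in> pverts G \<and> (a = b \<or> (a, b) \<in> parcs G) \<and> lazy_walk (b # w)"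
  by (auto simp: lazy_walk_def)

lemma lazy_walk_vwalk: "vwalk p (with_proj G) \<Longrightarrow> lazy_walk p"
  by (auto simp: lazy_walk_def vwalk_iff_successively elim: successively_mono)

lemma vwalk_remdups_adj: "lazy_walk w \<Longrightarrow> vwalk (remdups_adj w) (with_proj G)"
proof (induction w rule: remdups_adj.induct)
  case (3 x y xs)
  have "hd (remdups_adj (y # xs)) = y" "remdups_adj (y # xs) \<noteq> []" by simp_all
  then obtain zs where zs: "remdups_adj (y # xs) = y # zs"
    by (metis list.collapse)
  show ?case
    using 3 by (auto simp: lazy_walk_ConsCons vwalk_iff_successively zs)
qed (auto simp: lazy_walk_def vwalk_iff_successively)

text \<open>There are no loops, so consecutive vertices of a walk differ.\<close>

lemma remdups_adj_vwalk: "vwalk p (with_proj G) \<Longrightarrow> remdups_adj p = p"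
proof (induction p rule: remdups_adj.induct)
  case (3 x y xs)
  then show ?case by (auto simp: vwalk_iff_successively)
qed auto

lemma walk_weight_Units: "lazy_walk w \<Longrightarrow> walk_weight w \<in> Units K"
  by (induction w rule: walk_weight.induct) (auto simp: lazy_walk_ConsCons weight_Units)

lemma walk_weight_closed [simp]: "lazy_walk w \<Longrightarrow> walk_weight w \<in> carrier K"
  using walk_weight_Units by (auto simp: Units_def)

lemma walk_weight_append:
  assumes "lazy_walk (v @ w)" "v \<noteq> []" "w \<noteq> []"
  shows "walk_weight (v @ w) =
    walk_weight v \<otimes> (if last v = hd w then \<one> else s (last v) (hd w)) \<otimes> walk_weight w"
  using assms
proof (induction v rule: walk_weight.induct)
  case (1 a b v)
  then have l: "lazy_walk (b # v)" "lazy_walk w" "last (b # v) = hd w \<or> (last (b # v), hd w) \<in> parcs G"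
    "lazy_walk ((b # v) @ w)" "a = b \<or> (a, b) \<in> parcs G"
    using lazy_walk_append_iff[of "a # b # v" w] by (auto simp: lazy_walk_ConsCons)
  have "walk_weight ((a # b # v) @ w) = (if a = b then \<one> else s a b) \<otimes> walk_weight ((b # v) @ w)"
    by simp
  also have "walk_weight ((b # v) @ w) =
      walk_weight (b # v) \<otimes> (if last (b # v) = hd w then \<one> else s (last (b # v)) (hd w)) \<otimes> walk_weight w"
    using 1 l by simp
  finally show ?case
    using l by (auto simp: m_assoc)
next
  case ("2_2" a)
  then show ?case
    by (cases w) (auto simp: lazy_walk_ConsCons)
qed auto

section \<open>Multiplication in the groupoid algebra and the Laplace operator\<close>

lemma groupoid_module: "Module.module K A"
  unfolding groupoid_algebra_def by (rule basis_algebra_module)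

sublocale A: Module.module K A
  by (rule groupoid_module)

lemmas groupoid_mult_closed [simp, intro] =
  basis_mult_closed[where S = "homotopy_classes G" and m = "concat_classes G" and
    U = "(\<lambda>i. cls [i]) ` pverts G", folded groupoid_algebra_def]
lemmas groupoid_mult_simps [simp] =
  basis_mult_l_distr[where S = "homotopy_classes G" and m = "concat_classes G" and
    U = "(\<lambda>i. cls [i]) ` pverts G", folded groupoid_algebra_def]
  basis_mult_r_distr[where S = "homotopy_classes G" and m = "concat_classes G" and
    U = "(\<lambda>i. cls [i]) ` pverts G", folded groupoid_algebra_def]
  basis_mult_smult[where S = "homotopy_classes G" and m = "concat_classes G" and
    U = "(\<lambda>i. cls [i]) ` pverts G", folded groupoid_algebra_def]
  basis_mult_zero[where S = "homotopy_classes G" and m = "concat_classes G" and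
    U = "(\<lambda>i. cls [i]) ` pverts G", folded groupoid_algebra_def]
lemmas groupoid_mult_finsum =
  basis_mult_finsum[where S = "homotopy_classes G" and m = "concat_classes G" and
    U = "(\<lambda>i. cls [i]) ` pverts G", folded groupoid_algebra_def]

lemma class_elem_closed [simp]:
  "vwalk p (with_proj G) \<Longrightarrow> basis_elem K (cls p) \<in> carrier A"
  by (simp add: groupoid_algebra_def)

lemma walk_elem_closed [simp]: "walk_elem w \<in> carrier A"
  using vwalk_remdups_adj by (auto simp: walk_elem_def)

lemma class_elem_mult:
  assumes "vwalk p (with_proj G)" "vwalk q (with_proj G)"
  shows "basis_elem K (cls p) \<otimes>\<^bsub>A\<^esub> basis_elem K (cls q) =
    (if last p = hd q then basis_elem K (cls (p @ tl q)) else \<zero>\<^bsub>A\<^esub>)"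
  using assms vwalk_append_tl[OF assms]
  by (simp add: groupoid_algebra_def basis_mult_basis_elem concat_homotopy_class)

lemma one_closed_groupoid [simp]: "\<one>\<^bsub>A\<^esub> \<in> carrier A"
  unfolding groupoid_algebra_def
  by (rule basis_algebra_carrierI[where X = "(\<lambda>i. cls [i]) ` pverts G"])
    (auto simp: basis_algebra_simps)

lemma class_elem_mult_one:
  assumes p: "vwalk p (with_proj G)"
  shows "basis_elem K (cls p) \<otimes>\<^bsub>A\<^esub> \<one>\<^bsub>A\<^esub> = basis_elem K (cls p)"
  unfolding groupoid_algebra_def
proof (rule basis_mult_one_right)
  show "cls [last p] \<in> (\<lambda>i. cls [i]) ` pverts G"
    using vwalk_hd_last[OF p] by blast
  show "concat_classes G (cls p) (cls [last p]) = cls p"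
    using p vwalk_hd_last[OF p] by (simp add: concat_homotopy_class)
  show "concat_classes G (cls p) v \<notin> homotopy_classes G"
    if v: "v \<in> (\<lambda>i. cls [i]) ` pverts G" "v \<noteq> cls [last p]" for v
  proof -
    obtain i where "i \<in> pverts G" "v = cls [i]"
      using v(1) by blast
    moreover from this have "i \<noteq> last p"
      using v(2) by blast
    ultimately show ?thesis
      using p by (simp add: concat_homotopy_class)
  qed
qed (use p in auto)

lemma laplace_closed [simp]: "D \<in> carrier A"
  unfolding laplace_def edge_elem_def
  by (auto intro!: A.M.a_closed A.M.finsum_closed)

text \<open>At most one summand of \<open>D\<close> fits between \<open>p\<close> and
  \<open>q\<close>: the constant path if the end of \<open>p\<close> is the start of
  \<open>q\<close>, or the edge joining these two vertices. The alternatives exclude each other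
  because there are no loops.\<close>

lemma class_elem_laplace_mult:
  assumes p: "vwalk p (with_proj G)" and q: "vwalk q (with_proj G)"
  shows "basis_elem K (cls p) \<otimes>\<^bsub>A\<^esub> D \<otimes>\<^bsub>A\<^esub> basis_elem K (cls q) =
    (if last p = hd q then basis_elem K (cls (p @ tl q))
     else if (last p, hd q) \<in> parcs G then s (last p) (hd q) \<odot>\<^bsub>A\<^esub> basis_elem K (cls (p @ q))
     else \<zero>\<^bsub>A\<^esub>)"
proof -
  let ?p = "basis_elem K (cls p)" and ?q = "basis_elem K (cls q)"
  let ?e = "\<lambda>a. s (fst a) (snd a) \<odot>\<^bsub>A\<^esub> edge_elem K G (fst a) (snd a)"
  let ?r = "s (last p) (hd q) \<odot>\<^bsub>A\<^esub> basis_elem K (cls (p @ q))"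
  have pq: "vwalk (p @ q) (with_proj G)" if "(last p, hd q) \<in> parcs G"
    using that p q by (auto simp: vwalk_iff_successively successively_append_iff)
  have closed: "?e \<in> parcs G \<rightarrow> carrier A"
    by (auto simp: edge_elem_def)
  have edge: "?p \<otimes>\<^bsub>A\<^esub> ?e a \<otimes>\<^bsub>A\<^esub> ?q = (if (last p, hd q) = a then ?r else \<zero>\<^bsub>A\<^esub>)"
    if a: "a \<in> parcs G" for a
  proof -
    obtain i j where ij: "a = (i, j)" by fastforce
    have w: "vwalk (p @ [j]) (with_proj G)" if "last p = i"
      using vwalk_append_tl[OF p, of "[i, j]"] that a ij wellformed[of a] by simp
    \<comment> \<open>Traversing the edge appends its target \<open>j\<close>, which is the first
      vertex of \<open>q\<close> and is then dropped in the join.\<close>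
    have "(p @ [j]) @ tl q = p @ q" if "j = hd q"
      using that vwalk_hd_last(3)[OF q] by simp
    then show ?thesis
      using a p q w by (auto simp: ij edge_elem_def class_elem_mult)
  qed
  have "?p \<otimes>\<^bsub>A\<^esub> D \<otimes>\<^bsub>A\<^esub> ?q = ?p \<otimes>\<^bsub>A\<^esub> ?q \<oplus>\<^bsub>A\<^esub> (\<Oplus>\<^bsub>A\<^esub>a\<in>parcs G. ?p \<otimes>\<^bsub>A\<^esub> ?e a \<otimes>\<^bsub>A\<^esub> ?q)"
    unfolding laplace_def using closed p q
    by (simp add: class_elem_mult_one groupoid_mult_finsum A.M.finsum_closed Pi_iff)
  also have "(\<Oplus>\<^bsub>A\<^esub>a\<in>parcs G. ?p \<otimes>\<^bsub>A\<^esub> ?e a \<otimes>\<^bsub>A\<^esub> ?q) =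
      (\<Oplus>\<^bsub>A\<^esub>a\<in>parcs G. if (last p, hd q) = a then ?r else \<zero>\<^bsub>A\<^esub>)"
  proof (rule A.M.finsum_cong')
    show "(\<lambda>a. if (last p, hd q) = a then ?r else \<zero>\<^bsub>A\<^esub>) \<in> parcs G \<rightarrow> carrier A"
      using pq by auto
  qed (use edge in blast)+
  also have "\<dots> = (if (last p, hd q) \<in> parcs G then ?r else \<zero>\<^bsub>A\<^esub>)"
  proof (cases "(last p, hd q) \<in> parcs G")
    case True
    then show ?thesis
      using pq A.M.finsum_singleton[OF True pair_finite_arcs, of "\<lambda>_. ?r"] True by simp
  qed (auto intro: A.M.add.finprod_one_eqI)
  finally show ?thesis
    using p q vwalk_append_tl[OF p q] no_loops
    by (auto simp: class_elem_mult vwalk_iff_successively successively_append_iff)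
qed

text \<open>This is what makes the map on words multiplicative for the product of the homotope. The
  alternatives of \<open>class_elem_laplace_mult\<close> match the junction factor in the weight of
  \<open>v @ w\<close>.\<close>

lemma walk_elem_append:
  assumes "v \<noteq> []" "w \<noteq> []"
  shows "walk_elem (v @ w) = walk_elem v \<otimes>\<^bsub>A\<^esub> D \<otimes>\<^bsub>A\<^esub> walk_elem w"
proof (cases "lazy_walk v \<and> lazy_walk w")
  case True
  let ?v = "remdups_adj v" and ?w = "remdups_adj w"
  have vw: "vwalk ?v (with_proj G)" "vwalk ?w (with_proj G)"
    using True vwalk_remdups_adj by auto
  \<comment> \<open>If \<open>v\<close> ends with the first letter of \<open>w\<close>, the two
    copies merge, which corresponds to the summand \<open>1\<close> of \<open>D\<close>. Otherwise
    nothing changes at the junction.\<close>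
  have rem: "remdups_adj (v @ w) = (if last v = hd w then ?v @ tl ?w else ?v @ ?w)"
  proof (cases "last v = hd w")
    case True
    obtain v' x w' where "v = v' @ [x]" "w = x # w'"
      using True assms by (metis append_butlast_last_id list.collapse)
    then show ?thesis
      using remdups_adj_append[of v' x "x # w'"] by simp
  qed (simp add: remdups_adj_append')
  have "walk_elem v \<otimes>\<^bsub>A\<^esub> D \<otimes>\<^bsub>A\<^esub> walk_elem w =
      walk_weight v \<odot>\<^bsub>A\<^esub> (walk_weight w \<odot>\<^bsub>A\<^esub> (basis_elem K (cls ?v) \<otimes>\<^bsub>A\<^esub> D \<otimes>\<^bsub>A\<^esub> basis_elem K (cls ?w)))"
    using True vw by (simp add: walk_elem_def A.smult_assoc1[symmetric] m_comm)
  also have "\<dots> = walk_elem (v @ w)"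
    unfolding class_elem_laplace_mult[OF vw]
    using True vw lazy_walk_append_iff[OF assms] walk_weight_append[OF _ assms]
      vwalk_remdups_adj[of "v @ w"]
    by (auto simp: walk_elem_def rem A.smult_assoc1 m_ac)
  finally show ?thesis ..
next
  case False
  then show ?thesis
    using lazy_walk_append_iff[OF assms] vwalk_remdups_adj by (auto simp: walk_elem_def)
qed

section \<open>The homomorphism from the free algebra onto the unitization\<close>

abbreviation "F \<equiv> free_algebra K (pverts G)"
abbreviation "I \<equiv> B_ideal K G s"
abbreviation word :: "'v list \<Rightarrow> 'v list \<Rightarrow> 'k" where "word \<equiv> basis_elem K"

sublocale F: ring F
  unfolding free_algebra_def by (rule basis_algebra_ring) auto

sublocale FM: Module.module K F
  unfolding free_algebra_def by (rule basis_algebra_module)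

lemmas free_induct =
  basis_algebra_induct[where S = "lists (pverts G)" and m = "(@)" and U = "{[]}",
    folded free_algebra_def, consumes 1, case_names zero basis add smult]
lemmas free_mult_smult [simp] =
  basis_mult_smult[where S = "lists (pverts G)" and m = "(@)" and U = "{[]}",
    folded free_algebra_def]

lemma free_apply_Nil [simp]:
  "\<zero>\<^bsub>F\<^esub> [] = \<zero>" "(f \<oplus>\<^bsub>F\<^esub> g) [] = f [] \<oplus> g []" "(k \<odot>\<^bsub>F\<^esub> f) [] = k \<otimes> f []"
  by (simp_all add: free_algebra_def basis_algebra_simps)

lemma free_apply_closed [simp]: "f \<in> carrier F \<Longrightarrow> f w \<in> carrier K"
  by (simp add: free_algebra_def basis_algebra_carrier_iff)

lemma word_closed [simp]: "w \<in> lists (pverts G) \<Longrightarrow> word w \<in> carrier F"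
  by (simp add: free_algebra_def)

lemma word_append:
  "v \<in> lists (pverts G) \<Longrightarrow> w \<in> lists (pverts G) \<Longrightarrow> word (v @ w) = word v \<otimes>\<^bsub>F\<^esub> word w"
  by (simp add: free_algebra_def basis_mult_basis_elem del: append_in_lists_conv)
    (simp add: append_in_lists_conv)

lemma word_Nil: "word [] = \<one>\<^bsub>F\<^esub>"
  by (auto simp: free_algebra_def basis_algebra_simps basis_elem_def)

lemma word_apply_Nil [simp]: "word w [] = (if w = [] then \<one> else \<zero>)"
  by (simp add: basis_elem_def)

definition walk_map :: "('v list \<Rightarrow> 'k) \<Rightarrow> 'v list set \<Rightarrow> 'k"
  where "walk_map f = lin_ext K A walk_elem f"

lemma walk_map_simps [simp]:
  "f \<in> carrier F \<Longrightarrow> walk_map f \<in> carrier A"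
  "f \<in> carrier F \<Longrightarrow> g \<in> carrier F \<Longrightarrow> walk_map (f \<oplus>\<^bsub>F\<^esub> g) = walk_map f \<oplus>\<^bsub>A\<^esub> walk_map g"
  "k \<in> carrier K \<Longrightarrow> f \<in> carrier F \<Longrightarrow> walk_map (k \<odot>\<^bsub>F\<^esub> f) = k \<odot>\<^bsub>A\<^esub> walk_map f"
  "w \<in> lists (pverts G) \<Longrightarrow> walk_map (word w) = walk_elem w"
  "walk_map \<zero>\<^bsub>F\<^esub> = \<zero>\<^bsub>A\<^esub>"
  unfolding walk_map_def free_algebra_def
  by (auto intro!: A.lin_ext_closed A.lin_ext_add A.lin_ext_smult A.lin_ext_basis_elem A.lin_ext_zero)

lemma walk_elem_Nil [simp]: "walk_elem [] = \<zero>\<^bsub>A\<^esub>"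
  by (simp add: walk_elem_def lazy_walk_def)

lemma walk_elem_vertex [simp]: "i \<in> pverts G \<Longrightarrow> walk_elem [i] = vertex_elem K G i"
  by (simp add: walk_elem_def lazy_walk_def vertex_elem_def)

abbreviation "H \<equiv> groupoid_homotope K G s"
abbreviation "U \<equiv> unitization K H"

lemma homotope_simps [simp]:
  "carrier H = carrier A" "f \<oplus>\<^bsub>H\<^esub> g = f \<oplus>\<^bsub>A\<^esub> g" "f \<otimes>\<^bsub>H\<^esub> g = f \<otimes>\<^bsub>A\<^esub> D \<otimes>\<^bsub>A\<^esub> g"
  "k \<odot>\<^bsub>H\<^esub> f = k \<odot>\<^bsub>A\<^esub> f" "\<zero>\<^bsub>H\<^esub> = \<zero>\<^bsub>A\<^esub>"
  by (simp_all add: groupoid_homotope_def homotope_def)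

text \<open>The unit of \<open>F\<close> is the empty word, which \<open>walk_map\<close> kills; the
  first component sends it to the adjoined unit.\<close>

definition unital_walk_map :: "('v list \<Rightarrow> 'k) \<Rightarrow> 'k \<times> ('v list set \<Rightarrow> 'k)"
  where "unital_walk_map f = (f [], walk_map f)"

text \<open>A concatenation is empty only if both words are. The coefficient at the empty word is
  therefore multiplicative: it is the augmentation of the free algebra.\<close>

lemma mult_apply_Nil:
  assumes "f \<in> carrier F" "g \<in> carrier F"
  shows "(f \<otimes>\<^bsub>F\<^esub> g) [] = f [] \<otimes> g []"
  using assms(1)
proof (induction rule: free_induct)
  case (basis v)
  show ?case using assms(2)
  proof (induction rule: free_induct)
    case (basis w)
    then show ?case using \<open>v \<in> _\<close> by (simp flip: word_append)
  qed (use basis in \<open>simp_all add: F.r_distr r_distr m_lcomm\<close>)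
qed (use assms(2) in \<open>simp_all add: F.l_distr l_distr m_assoc\<close>)

text \<open>The right-hand side is the second component of a product in the unitization. On words,
  \<open>walk_elem_append\<close> covers two nonempty factors, and the first two terms cover an
  empty one.\<close>

lemma walk_map_mult:
  assumes "f \<in> carrier F" "g \<in> carrier F"
  shows "walk_map (f \<otimes>\<^bsub>F\<^esub> g) =
    f [] \<odot>\<^bsub>A\<^esub> walk_map g \<oplus>\<^bsub>A\<^esub> g [] \<odot>\<^bsub>A\<^esub> walk_map f \<oplus>\<^bsub>A\<^esub> walk_map f \<otimes>\<^bsub>A\<^esub> D \<otimes>\<^bsub>A\<^esub> walk_map g"
  using assms(1)
proof (induction rule: free_induct)
  case (basis v)
  show ?case using assms(2)
  proof (induction rule: free_induct)
    case (basis w)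
    then show ?case using \<open>v \<in> _\<close>
      by (cases "v = []"; cases "w = []") (simp_all add: walk_elem_append flip: word_append)
  next
    case (add f g)
    then show ?case using \<open>v \<in> _\<close>
      by (simp add: F.r_distr A.smult_l_distr A.smult_r_distr A.M.a_ac)
  next
    case (smult k f)
    then show ?case using \<open>v \<in> _\<close>
      by (simp add: A.smult_r_distr A.smult_assoc1[symmetric] m_comm)
  qed (use basis in simp)
next
  case (add f f')
  then show ?case using assms(2)
    by (simp add: F.l_distr A.smult_l_distr A.smult_r_distr A.M.a_ac)
next
  case (smult k f)
  then show ?case using assms(2)
    by (simp add: A.smult_r_distr A.smult_assoc1[symmetric] m_comm)
qed (use assms(2) in simp)

lemma unital_walk_map_hom: "unital_walk_map \<in> ring_hom F U"
  by (rule ring_hom_memI)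
    (auto simp: unital_walk_map_def unitization_def mult_apply_Nil walk_map_mult word_Nil[symmetric])

section \<open>A linear section from chosen representatives\<close>

definition representative :: "'v list set \<Rightarrow> 'v list"
  where "representative c = (SOME p. vwalk p (with_proj G) \<and> cls p = c)"

lemma representative:
  assumes "c \<in> homotopy_classes G"
  shows "vwalk (representative c) (with_proj G)" "cls (representative c) = c"
proof -
  have "\<exists>p. vwalk p (with_proj G) \<and> cls p = c"
    using assms by (auto simp: homotopy_classes_def)
  from someI_ex[OF this] show "vwalk (representative c) (with_proj G)" "cls (representative c) = c"
    by (auto simp: representative_def)
qed

lemma vwalk_in_lists: "vwalk p (with_proj G) \<Longrightarrow> p \<in> lists (pverts G)"
  by (auto simp: vwalk_iff_successively)

text \<open>Scaled so that \<open>walk_map\<close> sends it to the basis element of the class of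
  \<open>p\<close> with coefficient one.\<close>

definition normalized_word :: "'v list \<Rightarrow> 'v list \<Rightarrow> 'k"
  where "normalized_word p = inv\<^bsub>K\<^esub> (walk_weight p) \<odot>\<^bsub>F\<^esub> word p"

lemma inv_weight_closed [simp]: "lazy_walk w \<Longrightarrow> inv\<^bsub>K\<^esub> (walk_weight w) \<in> carrier K"
  using walk_weight_Units by simp

lemma normalized_word_closed [simp]:
  "vwalk p (with_proj G) \<Longrightarrow> normalized_word p \<in> carrier F"
  by (simp add: normalized_word_def lazy_walk_vwalk vwalk_in_lists)

text \<open>Constructed as a linear map only. Its values in \<open>F\<close> depend on the chosen
  representatives; by \<open>pr_normalized_word\<close> their cosets modulo \<open>I\<close> do
  not.\<close>

definition class_map :: "('v list set \<Rightarrow> 'k) \<Rightarrow> 'v list \<Rightarrow> 'k"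
  where "class_map g = lin_ext K F (\<lambda>c. normalized_word (representative c)) g"

lemma class_map_simps [simp]:
  "f \<in> carrier A \<Longrightarrow> class_map f \<in> carrier F"
  "f \<in> carrier A \<Longrightarrow> g \<in> carrier A \<Longrightarrow> class_map (f \<oplus>\<^bsub>A\<^esub> g) = class_map f \<oplus>\<^bsub>F\<^esub> class_map g"
  "k \<in> carrier K \<Longrightarrow> f \<in> carrier A \<Longrightarrow> class_map (k \<odot>\<^bsub>A\<^esub> f) = k \<odot>\<^bsub>F\<^esub> class_map f"
  "c \<in> homotopy_classes G \<Longrightarrow> class_map (basis_elem K c) = normalized_word (representative c)"
  "class_map \<zero>\<^bsub>A\<^esub> = \<zero>\<^bsub>F\<^esub>"
  unfolding class_map_def groupoid_algebra_def
  by (auto simp: representative(1) intro!: FM.lin_ext_closed FM.lin_ext_add FM.lin_ext_smult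
      FM.lin_ext_basis_elem FM.lin_ext_zero)

lemmas groupoid_induct =
  basis_algebra_induct[where S = "homotopy_classes G" and m = "concat_classes G" and
    U = "(\<lambda>i. cls [i]) ` pverts G", folded groupoid_algebra_def, consumes 1,
    case_names zero basis add smult]

lemma walk_map_class_map:
  assumes "g \<in> carrier A"
  shows "walk_map (class_map g) = g" "class_map g [] = \<zero>"
proof -
  have "walk_map (class_map g) = g \<and> class_map g [] = \<zero>"
    using assms
  proof (induction rule: groupoid_induct)
    case (basis c)
    let ?p = "representative c"
    have p: "vwalk ?p (with_proj G)" "cls ?p = c"
      using representative[OF basis] .
    have l: "lazy_walk ?p" using lazy_walk_vwalk p(1) .
    have "basis_elem K c \<in> carrier A"
      using basis by (simp add: groupoid_algebra_def)
    then show ?case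
      using basis l p walk_weight_Units[OF l]
      by (simp add: normalized_word_def vwalk_in_lists walk_elem_def remdups_adj_vwalk vwalk_hd_last
          A.smult_assoc1[symmetric])
  qed simp_all
  then show "walk_map (class_map g) = g" "class_map g [] = \<zero>" by auto
qed

lemma unital_walk_map_surj: "unital_walk_map ` carrier F = carrier U"
proof
  show "unital_walk_map ` carrier F \<subseteq> carrier U"
    using ring_hom_closed[OF unital_walk_map_hom] by blast
  show "carrier U \<subseteq> unital_walk_map ` carrier F"
  proof
    fix x assume "x \<in> carrier U"
    then obtain k g where x: "x = (k, g)" "k \<in> carrier K" "g \<in> carrier A"
      by (auto simp: unitization_def)
    \<comment> \<open>The two components are hit independently: the empty word contributes nothing
      to the second, and \<open>class_map g\<close> nothing to the first.\<close>
    then have "unital_walk_map (k \<odot>\<^bsub>F\<^esub> word [] \<oplus>\<^bsub>F\<^esub> class_map g) = x"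
      by (simp add: unital_walk_map_def walk_map_class_map)
    moreover have "k \<odot>\<^bsub>F\<^esub> word [] \<oplus>\<^bsub>F\<^esub> class_map g \<in> carrier F"
      using x by simp
    ultimately show "x \<in> unital_walk_map ` carrier F" by blast
  qed
qed

text \<open>
  As an image of the free algebra, the unitization inherits the ring axioms, so associativity
  of the groupoid algebra need not be checked.
\<close>

lemma unitization_ring: "ring U"
proof -
  \<comment> \<open>The ring structure on an image comes with these two fields replaced;
    surjectivity shows that they are those of \<open>U\<close>.\<close>
  have "U\<lparr>carrier := unital_walk_map ` carrier F, zero := unital_walk_map \<zero>\<^bsub>F\<^esub>\<rparr> = U"
    unfolding unital_walk_map_surj by (simp add: unital_walk_map_def unitization_def)
  then show ?thesis
    using F.ring_hom_imp_img_ring[OF unital_walk_map_hom] by simp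
qed

sublocale walk_map: ring_hom_ring F U unital_walk_map
  using F.ring_axioms unitization_ring unital_walk_map_hom by (rule ring_hom_ringI2)

section \<open>Words modulo the relations\<close>

abbreviation "pr f \<equiv> I +>\<^bsub>F\<^esub> f"

lemma relations_closed: "B_relations K G s \<subseteq> carrier F"
  by (auto simp: B_relations_def Let_def intro!: F.minus_closed F.m_closed FM.smult_closed)

sublocale I: ideal I F
  unfolding B_ideal_def by (rule F.genideal_ideal[OF relations_closed])

lemma relation_in_ideal: "r \<in> B_relations K G s \<Longrightarrow> r \<in> I"
  unfolding B_ideal_def using F.genideal_self[OF relations_closed] by blast

lemma pr_eq_iff: "f \<in> carrier F \<Longrightarrow> g \<in> carrier F \<Longrightarrow> pr f = pr g \<longleftrightarrow> f \<ominus>\<^bsub>F\<^esub> g \<in> I"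
  using F.quotient_eq_iff_same_a_r_cos[OF I.ideal_axioms] by blast

lemma pr_mult_cong:
  assumes "f \<in> carrier F" "f' \<in> carrier F" "g \<in> carrier F" "g' \<in> carrier F" "pr f = pr f'" "pr g = pr g'"
  shows "pr (f \<otimes>\<^bsub>F\<^esub> g) = pr (f' \<otimes>\<^bsub>F\<^esub> g')"
  using assms ring_hom_mult[OF I.rcos_ring_hom] by metis

lemma pr_add_cong:
  assumes "f \<in> carrier F" "f' \<in> carrier F" "g \<in> carrier F" "g' \<in> carrier F" "pr f = pr f'" "pr g = pr g'"
  shows "pr (f \<oplus>\<^bsub>F\<^esub> g) = pr (f' \<oplus>\<^bsub>F\<^esub> g')"
  using assms ring_hom_add[OF I.rcos_ring_hom] by metis

text \<open>Since \<open>I\<close> is generated as a ring ideal, compatibility with scalars is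
  obtained by reading a scalar as the ring element \<open>k\<close> times the unit.\<close>

lemma smult_eq_mult: "k \<in> carrier K \<Longrightarrow> f \<in> carrier F \<Longrightarrow> k \<odot>\<^bsub>F\<^esub> f = (k \<odot>\<^bsub>F\<^esub> \<one>\<^bsub>F\<^esub>) \<otimes>\<^bsub>F\<^esub> f"
  by simp

lemma pr_smult_cong:
  assumes "k \<in> carrier K" "f \<in> carrier F" "f' \<in> carrier F" "pr f = pr f'"
  shows "pr (k \<odot>\<^bsub>F\<^esub> f) = pr (k \<odot>\<^bsub>F\<^esub> f')"
  unfolding smult_eq_mult[OF assms(1,2)] smult_eq_mult[OF assms(1,3)]
  by (rule pr_mult_cong) (use assms in simp_all)

text \<open>A two-sided ideal allows rewriting inside a word. The scalar \<open>k\<close> covers all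
  three kinds of relation: one for a repeated letter, the squared weight for a backtracking, zero
  for nonadjacent letters.\<close>

lemma pr_word_context:
  assumes "pr (word m) = pr (k \<odot>\<^bsub>F\<^esub> word m')" "k \<in> carrier K"
    and "u \<in> lists (pverts G)" "m \<in> lists (pverts G)" "m' \<in> lists (pverts G)" "v \<in> lists (pverts G)"
  shows "pr (word (u @ m @ v)) = pr (k \<odot>\<^bsub>F\<^esub> word (u @ m' @ v))"
proof -
  have "pr (word u \<otimes>\<^bsub>F\<^esub> (word m \<otimes>\<^bsub>F\<^esub> word v)) =
      pr (word u \<otimes>\<^bsub>F\<^esub> ((k \<odot>\<^bsub>F\<^esub> word m') \<otimes>\<^bsub>F\<^esub> word v))"
    by (intro pr_mult_cong assms(1)) (use assms in simp_all)
  then show ?thesis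
    using assms by (simp add: word_append)
qed

lemma pr_word_idem:
  assumes "i \<in> pverts G"
  shows "pr (word [i, i]) = pr (word [i])"
proof -
  have "word [i] \<otimes>\<^bsub>F\<^esub> word [i] \<ominus>\<^bsub>F\<^esub> word [i] \<in> I"
    by (rule relation_in_ideal) (use assms in \<open>auto simp: B_relations_def Let_def\<close>)
  then show ?thesis
    using assms word_append[of "[i]" "[i]"] by (simp add: pr_eq_iff)
qed

lemma pr_word_edge:
  assumes "(i, j) \<in> parcs G"
  shows "pr (word [i, j, i]) = pr ((s i j \<otimes> s i j) \<odot>\<^bsub>F\<^esub> word [i])"
proof -
  have "word [i] \<otimes>\<^bsub>F\<^esub> word [j] \<otimes>\<^bsub>F\<^esub> word [i] \<ominus>\<^bsub>F\<^esub> (s i j [^] (2::nat)) \<odot>\<^bsub>F\<^esub> word [i] \<in> I"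
    by (rule relation_in_ideal) (use assms in \<open>auto simp: B_relations_def Let_def\<close>)
  then show ?thesis
    using assms word_append[of "[i]" "[j]"] word_append[of "[i, j]" "[i]"]
    by (simp add: pr_eq_iff numeral_2_eq_2)
qed

lemma pr_word_nonadjacent:
  assumes "i \<in> pverts G" "j \<in> pverts G" "i \<noteq> j" "(i, j) \<notin> parcs G"
  shows "pr (word [i, j]) = pr \<zero>\<^bsub>F\<^esub>"
proof -
  have "word [i] \<otimes>\<^bsub>F\<^esub> word [j] \<in> I"
    by (rule relation_in_ideal) (use assms in \<open>auto simp: B_relations_def Let_def\<close>)
  then show ?thesis
    using assms word_append[of "[i]" "[j]"] by (simp add: pr_eq_iff F.minus_eq)
qed

lemma pr_word_Cons_cong:
  assumes "i \<in> pverts G" "w \<in> lists (pverts G)" "f \<in> carrier F" "pr (word w) = pr f"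
  shows "pr (word (i # w)) = pr (word [i] \<otimes>\<^bsub>F\<^esub> f)"
proof -
  have "pr (word [i] \<otimes>\<^bsub>F\<^esub> word w) = pr (word [i] \<otimes>\<^bsub>F\<^esub> f)"
    by (rule pr_mult_cong) (use assms in simp_all)
  then show ?thesis
    using assms word_append[of "[i]" w] by simp
qed

lemma pr_word_remdups_adj:
  "w \<in> lists (pverts G) \<Longrightarrow> pr (word w) = pr (word (remdups_adj w))"
proof (induction w rule: remdups_adj.induct)
  case (3 x y xs)
  then have xs: "x \<in> pverts G" "y \<in> pverts G" "xs \<in> lists (pverts G)" by auto
  show ?case
  proof (cases "x = y")
    case True
    then have "pr (word (x # y # xs)) = pr (word (y # xs))"
      using pr_word_context[of "[y, y]" \<one> "[y]" "[]" xs] xs pr_word_idem by simp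
    then show ?thesis using 3 True by simp
  next
    case False
    have r: "remdups_adj (y # xs) \<in> lists (pverts G)"
      using xs by (simp add: in_lists_conv_set)
    have "pr (word (x # y # xs)) = pr (word [x] \<otimes>\<^bsub>F\<^esub> word (remdups_adj (y # xs)))"
      by (rule pr_word_Cons_cong) (use 3 False xs r in auto)
    then show ?thesis
      using False word_append[of "[x]" "remdups_adj (y # xs)"] xs r by simp
  qed
qed auto

text \<open>Some pair of consecutive letters is distinct and nonadjacent, and one such pair makes
  the whole word vanish. The empty word must be excluded, as it is the unit.\<close>

lemma pr_word_not_lazy:
  "w \<in> lists (pverts G) \<Longrightarrow> w \<noteq> [] \<Longrightarrow> \<not> lazy_walk w \<Longrightarrow> pr (word w) = pr \<zero>\<^bsub>F\<^esub>"
proof (induction w rule: walk_weight.induct)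
  case (1 a b w)
  then have w: "a \<in> pverts G" "b \<in> pverts G" "w \<in> lists (pverts G)" by auto
  show ?case
  proof (cases "a = b \<or> (a, b) \<in> parcs G")
    case True
    then have "pr (word (b # w)) = pr \<zero>\<^bsub>F\<^esub>"
      using 1 w by (auto simp: lazy_walk_ConsCons)
    from pr_word_Cons_cong[OF _ _ _ this, of a] show ?thesis
      using w by simp
  next
    case False
    \<comment> \<open>Zero is written as a scalar multiple of a word to fit
      \<open>pr_word_context\<close>.\<close>
    then have "pr (word [a, b]) = pr (\<zero> \<odot>\<^bsub>F\<^esub> word [])"
      using pr_word_nonadjacent w by simp
    from pr_word_context[OF this, of "[]" w] show ?thesis
      using w by simp
  qed
qed (auto simp: lazy_walk_def)

text \<open>The edge is crossed in both directions, and symmetry of the weights turns the two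
  factors into a square. The junction with the prefix \<open>p\<close> sees only the vertex
  \<open>a\<close>, so it contributes equally to both sides.\<close>

lemma walk_weight_backtrack:
  assumes "vwalk (p @ [a, b, a] @ q) (with_proj G)"
  shows "walk_weight (p @ [a, b, a] @ q) = (s a b \<otimes> s a b) \<otimes> walk_weight (p @ [a] @ q)"
proof -
  have w: "vwalk (a # b # a # q) (with_proj G)" "vwalk (a # q) (with_proj G)"
    using assms by (auto simp: vwalk_iff_successively successively_append_iff successively_Cons)
  then have ab: "(a, b) \<in> parcs G" "a \<noteq> b"
    by (auto simp: vwalk_iff_successively)
  have base: "walk_weight (a # b # a # q) = (s a b \<otimes> s a b) \<otimes> walk_weight (a # q)"
    using ab w weight_sym[OF ab(1)] lazy_walk_vwalk[OF w(2)] by (simp add: m_assoc)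
  show ?thesis
  proof (cases "p = []")
    case True
    then show ?thesis using base by simp
  next
    case False
    have l: "lazy_walk (p @ a # b # a # q)"
      using lazy_walk_vwalk[OF assms] by simp
    then have l': "lazy_walk p" "lazy_walk (p @ a # q)" "last p = a \<or> (last p, a) \<in> parcs G"
      using False lazy_walk_append_iff[OF False, of "a # b # a # q"]
        lazy_walk_append_iff[OF False, of "a # q"] lazy_walk_vwalk[OF w(2)] by auto
    show ?thesis
      using walk_weight_append[OF l False] walk_weight_append[OF l'(2) False] l' base ab
        lazy_walk_vwalk[OF w(2)]
      by (auto simp: m_ac)
  qed
qed

lemma walk_weight_remdups_adj: "lazy_walk w \<Longrightarrow> walk_weight (remdups_adj w) = walk_weight w"
proof (induction w rule: remdups_adj.induct)
  case (3 x y xs)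
  obtain zs where zs: "remdups_adj (y # xs) = y # zs"
    by (metis hd_remdups_adj list.collapse list.sel(1) list.simps(3) remdups_adj_Nil_iff)
  show ?case
    using 3 zs by (auto simp: lazy_walk_ConsCons)
qed auto

lemma pr_normalized_word:
  "homotopic_paths G p q \<Longrightarrow> pr (normalized_word p) = pr (normalized_word q)"
proof (induction rule: homotopic_paths.induct)
  case (backtrack p a b q)
  let ?v = "p @ [a, b, a] @ q" and ?w = "p @ [a] @ q"
  have w: "vwalk ?w (with_proj G)"
    using homotopic_pathsD[OF homotopic_paths.backtrack[OF backtrack]] by blast
  have ab: "(a, b) \<in> parcs G"
    using backtrack by (auto simp: vwalk_iff_successively successively_append_iff)
  have units: "walk_weight ?w \<in> Units K" "walk_weight ?v \<in> Units K" "s a b \<otimes> s a b \<in> Units K"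
    using w backtrack ab by (auto intro: walk_weight_Units lazy_walk_vwalk weight_Units)
  \<comment> \<open>The weight of \<open>?w\<close> and its inverse are inserted, so that the
    squared edge weight is absorbed into the weight of \<open>?v\<close>.\<close>
  have "inv\<^bsub>K\<^esub> (walk_weight ?v) \<otimes> (s a b \<otimes> s a b) =
      inv\<^bsub>K\<^esub> (walk_weight ?v) \<otimes> ((s a b \<otimes> s a b) \<otimes> walk_weight ?w) \<otimes> inv\<^bsub>K\<^esub> (walk_weight ?w)"
    using units(1,2) ab by (simp add: m_assoc Units_closed)
  also have "\<dots> = inv\<^bsub>K\<^esub> (walk_weight ?v) \<otimes> walk_weight ?v \<otimes> inv\<^bsub>K\<^esub> (walk_weight ?w)"
    by (simp add: walk_weight_backtrack[OF backtrack, simplified])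
  also have "\<dots> = inv\<^bsub>K\<^esub> (walk_weight ?w)"
    using units(1,2) by (simp only: Units_l_inv l_one Units_inv_closed)
  finally have eq: "inv\<^bsub>K\<^esub> (walk_weight ?v) \<otimes> (s a b \<otimes> s a b) = inv\<^bsub>K\<^esub> (walk_weight ?w)" .
  have lists: "p \<in> lists (pverts G)" "q \<in> lists (pverts G)"
    using vwalk_in_lists[OF w] by auto
  have "pr (word ?v) = pr ((s a b \<otimes> s a b) \<odot>\<^bsub>F\<^esub> word ?w)"
    by (rule pr_word_context[OF pr_word_edge[OF ab]]) (use ab lists in auto)
  then have "pr (normalized_word ?v) =
      pr (inv\<^bsub>K\<^esub> (walk_weight ?v) \<odot>\<^bsub>F\<^esub> ((s a b \<otimes> s a b) \<odot>\<^bsub>F\<^esub> word ?w))"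
    unfolding normalized_word_def
    by (intro pr_smult_cong) (use units ab lists in auto)
  then show ?case
    unfolding normalized_word_def
    using eq units ab lists by (simp add: FM.smult_assoc1[symmetric])
qed auto

text \<open>Modulo the relations \<open>f\<close> can be recovered from the two components of its
  image. An \<open>f\<close> with both components zero therefore lies in \<open>I\<close>, which is
  the injectivity half of the isomorphism.\<close>

lemma pr_class_map:
  assumes "f \<in> carrier F"
  shows "pr f = pr (f [] \<odot>\<^bsub>F\<^esub> \<one>\<^bsub>F\<^esub> \<oplus>\<^bsub>F\<^esub> class_map (walk_map f))"
  using assms
proof (induction rule: free_induct)
  case (basis w)
  consider "w = []" | "w \<noteq> []" "\<not> lazy_walk w" | "w \<noteq> []" "lazy_walk w" by blast
  then show ?case
  proof cases
    case 2
    then show ?thesis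
      using basis pr_word_not_lazy[OF basis] by (simp add: walk_elem_def)
  next
    case 3
    let ?w = "remdups_adj w" and ?p = "representative (cls (remdups_adj w))"
    have w: "vwalk ?w (with_proj G)" using 3(2) by (rule vwalk_remdups_adj)
    then have c: "cls ?w \<in> homotopy_classes G" by simp
    have p: "vwalk ?p (with_proj G)" "homotopic_paths G ?p ?w"
      using representative[OF c] homotopy_class_eq_iff by auto
    have "class_map (walk_elem w) = walk_weight w \<odot>\<^bsub>F\<^esub> normalized_word ?p"
      using 3 w c by (simp add: walk_elem_def)
    \<comment> \<open>The chosen representative may differ from the walk obtained from
      \<open>w\<close>, but the two are homotopic.\<close>
    moreover have "pr (walk_weight w \<odot>\<^bsub>F\<^esub> normalized_word ?p) =
        pr (walk_weight w \<odot>\<^bsub>F\<^esub> normalized_word ?w)"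
      by (rule pr_smult_cong) (use 3 w p pr_normalized_word in auto)
    moreover have "walk_weight w \<odot>\<^bsub>F\<^esub> normalized_word ?w = word ?w"
      using 3 w walk_weight_Units[OF 3(2)]
      by (simp add: normalized_word_def walk_weight_remdups_adj vwalk_in_lists FM.smult_assoc1[symmetric])
    moreover have "class_map (walk_elem w) \<in> carrier F" by simp
    ultimately show ?thesis
      using basis 3 pr_word_remdups_adj[OF basis] by simp
  qed (simp add: word_Nil[symmetric])
next
  case (add f g)
  then have "pr (f \<oplus>\<^bsub>F\<^esub> g) = pr ((f [] \<odot>\<^bsub>F\<^esub> \<one>\<^bsub>F\<^esub> \<oplus>\<^bsub>F\<^esub> class_map (walk_map f)) \<oplus>\<^bsub>F\<^esub>
      (g [] \<odot>\<^bsub>F\<^esub> \<one>\<^bsub>F\<^esub> \<oplus>\<^bsub>F\<^esub> class_map (walk_map g)))"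
    by (intro pr_add_cong) auto
  then show ?case
    using add by (simp add: FM.smult_l_distr F.a_ac)
next
  case (smult k f)
  then have "pr (k \<odot>\<^bsub>F\<^esub> f) = pr (k \<odot>\<^bsub>F\<^esub> (f [] \<odot>\<^bsub>F\<^esub> \<one>\<^bsub>F\<^esub> \<oplus>\<^bsub>F\<^esub> class_map (walk_map f)))"
    by (intro pr_smult_cong) auto
  then show ?case
    using smult by (simp add: FM.smult_r_distr FM.smult_assoc1)
qed simp

lemma diff_in_kernel:
  assumes "f \<in> carrier F" "g \<in> carrier F" "f [] = g []" "walk_map f = walk_map g"
  shows "f \<ominus>\<^bsub>F\<^esub> g \<in> a_kernel F U unital_walk_map"
proof -
  have "unital_walk_map f = unital_walk_map g"
    using assms(3,4) by (simp add: unital_walk_map_def)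
  then have "unital_walk_map (f \<ominus>\<^bsub>F\<^esub> g) = \<zero>\<^bsub>U\<^esub>"
    unfolding F.minus_eq walk_map.hom_add[OF assms(1) F.a_inv_closed[OF assms(2)]]
      walk_map.hom_a_inv[OF assms(2)]
    using walk_map.S.r_neg[OF walk_map.hom_closed[OF assms(2)]] by simp
  then show ?thesis
    unfolding a_kernel_def' using F.minus_closed[OF assms(1,2)] by blast
qed

lemma kernel_unital_walk_map: "a_kernel F U unital_walk_map = I"
proof
  show "a_kernel F U unital_walk_map \<subseteq> I"
  proof
    fix f assume "f \<in> a_kernel F U unital_walk_map"
    then have f: "f \<in> carrier F" "f [] = \<zero>" "walk_map f = \<zero>\<^bsub>A\<^esub>"
      by (auto simp: a_kernel_def' unital_walk_map_def unitization_def)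
    then have "pr f = pr \<zero>\<^bsub>F\<^esub>"
      using pr_class_map[OF f(1)] by simp
    then show "f \<in> I"
      using f(1) by (simp add: pr_eq_iff F.minus_eq)
  qed
  have "walk_elem [i, i] = walk_elem [i]" if "i \<in> pverts G" for i
    using that by (simp add: walk_elem_def lazy_walk_def)
  moreover have "walk_elem [i, j, i] = (s i j \<otimes> s i j) \<odot>\<^bsub>A\<^esub> walk_elem [i]" if "(i, j) \<in> parcs G" for i j
  proof -
    have ji: "(j, i) \<in> parcs G" "i \<noteq> j"
      using that arcs_symmetric by auto
    \<comment> \<open>Backtracking with empty context on both sides contracts to the constant
      path.\<close>
    have "cls [i, j, i] = cls [i]"
      using homotopic_paths.backtrack[of "[]" i j "[]" G] homotopy_class_eq_iff that ji by simp
    then show ?thesis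
      using that ji weight_sym[OF that] by (simp add: walk_elem_def lazy_walk_def)
  qed
  moreover have "walk_elem [i, j] = \<zero>\<^bsub>A\<^esub>" if "i \<noteq> j" "(i, j) \<notin> parcs G" for i j
    using that by (simp add: walk_elem_def lazy_walk_def)
  ultimately have walk_elem_relations:
    "i \<in> pverts G \<Longrightarrow> walk_elem [i, i] = walk_elem [i]"
    "(i, j) \<in> parcs G \<Longrightarrow> walk_elem [i, j, i] = (s i j \<otimes> s i j) \<odot>\<^bsub>A\<^esub> walk_elem [i]"
    "i \<noteq> j \<Longrightarrow> (i, j) \<notin> parcs G \<Longrightarrow> walk_elem [i, j] = \<zero>\<^bsub>A\<^esub>" for i j
    by blast+
  have "r \<in> a_kernel F U unital_walk_map" if "r \<in> B_relations K G s" for r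
  proof -
    from that consider
      (idem) i where "i \<in> pverts G" "r = word [i] \<otimes>\<^bsub>F\<^esub> word [i] \<ominus>\<^bsub>F\<^esub> word [i]"
    | (edge) i j where "(i, j) \<in> parcs G"
        "r = word [i] \<otimes>\<^bsub>F\<^esub> word [j] \<otimes>\<^bsub>F\<^esub> word [i] \<ominus>\<^bsub>F\<^esub> (s i j [^] (2::nat)) \<odot>\<^bsub>F\<^esub> word [i]"
    | (nonadjacent) i j where "i \<in> pverts G" "j \<in> pverts G" "i \<noteq> j" "(i, j) \<notin> parcs G"
        "r = word [i] \<otimes>\<^bsub>F\<^esub> word [j]"
      unfolding B_relations_def Let_def by blast
    then show ?thesis
    proof cases
      case idem
      then show ?thesis
        by (auto simp: walk_elem_relations simp flip: word_append intro!: diff_in_kernel)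
    next
      case edge
      then show ?thesis
        by (auto simp: walk_elem_relations numeral_2_eq_2 simp flip: word_append
            intro!: diff_in_kernel)
    next
      case nonadjacent
      then have "r = word [i, j]" by (simp flip: word_append)
      \<comment> \<open>This relation is a single word; subtracting zero brings it into the shape of
        \<open>diff_in_kernel\<close>.\<close>
      then have "r \<ominus>\<^bsub>F\<^esub> \<zero>\<^bsub>F\<^esub> \<in> a_kernel F U unital_walk_map" "r \<in> carrier F"
        using nonadjacent by (auto simp: walk_elem_relations intro!: diff_in_kernel)
      then show ?thesis by (simp add: F.minus_eq)
    qed
  qed
  then have "B_relations K G s \<subseteq> a_kernel F U unital_walk_map" by blast
  then show "I \<subseteq> a_kernel F U unital_walk_map"
    unfolding B_ideal_def by (intro F.genideal_minimal walk_map.kernel_is_ideal)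
qed

section \<open>The isomorphisms\<close>

abbreviation "B \<equiv> B_algebra K G s"

text \<open>Scalar multiplication on the quotient is a union over all members of a coset. They all
  yield the same coset, so the union collapses.\<close>

lemma pr_smult:
  assumes "k \<in> carrier K" "f \<in> carrier F"
  shows "k \<odot>\<^bsub>B\<^esub> pr f = pr (k \<odot>\<^bsub>F\<^esub> f)"
proof -
  have "pr (k \<odot>\<^bsub>F\<^esub> x) = pr (k \<odot>\<^bsub>F\<^esub> f)" if "x \<in> pr f" for x
  proof (rule pr_smult_cong)
    show "x \<in> carrier F"
      using that I.a_Hcarr assms(2) by (auto simp: a_r_coset_def')
    show "pr x = pr f"
      using I.a_repr_independence'[OF that assms(2)] by simp
  qed (use assms in auto)
  then have "(\<Union>x\<in>pr f. pr (k \<odot>\<^bsub>F\<^esub> x)) = (\<Union>x\<in>pr f. pr (k \<odot>\<^bsub>F\<^esub> f))"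
    by (rule SUP_cong[OF HOL.refl])
  \<comment> \<open>The index set contains \<open>f\<close>, so the union is not empty.\<close>
  also have "\<dots> = pr (k \<odot>\<^bsub>F\<^esub> f)"
    using I.a_rcos_self[OF assms(2)] by blast
  finally show ?thesis
    by (simp add: B_algebra_def quotient_algebra_def)
qed

lemma B_simps [simp]:
  "carrier B = (\<lambda>f. pr f) ` carrier F"
  "f \<in> carrier F \<Longrightarrow> g \<in> carrier F \<Longrightarrow> pr f \<oplus>\<^bsub>B\<^esub> pr g = pr (f \<oplus>\<^bsub>F\<^esub> g)"
  "f \<in> carrier F \<Longrightarrow> g \<in> carrier F \<Longrightarrow> pr f \<otimes>\<^bsub>B\<^esub> pr g = pr (f \<otimes>\<^bsub>F\<^esub> g)"
  "\<one>\<^bsub>B\<^esub> = pr \<one>\<^bsub>F\<^esub>" "\<zero>\<^bsub>B\<^esub> = pr \<zero>\<^bsub>F\<^esub>"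
  "B_gen K G s i = pr (word [i])"
proof -
  show "carrier B = (\<lambda>f. pr f) ` carrier F"
    by (auto simp: B_algebra_def quotient_algebra_def FactRing_def A_RCOSETS_def')
  show "pr f \<oplus>\<^bsub>B\<^esub> pr g = pr (f \<oplus>\<^bsub>F\<^esub> g)" "pr f \<otimes>\<^bsub>B\<^esub> pr g = pr (f \<otimes>\<^bsub>F\<^esub> g)"
    if "f \<in> carrier F" "g \<in> carrier F"
    using ring_hom_add[OF I.rcos_ring_hom that] ring_hom_mult[OF I.rcos_ring_hom that]
    by (simp_all add: B_algebra_def quotient_algebra_def)
  show "\<one>\<^bsub>B\<^esub> = pr \<one>\<^bsub>F\<^esub>"
    using ring_hom_one[OF I.rcos_ring_hom] by (simp add: B_algebra_def quotient_algebra_def)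
  have "pr \<zero>\<^bsub>F\<^esub> = I"
    by (rule I.a_rcos_const) simp
  then show "\<zero>\<^bsub>B\<^esub> = pr \<zero>\<^bsub>F\<^esub>"
    by (simp add: B_algebra_def quotient_algebra_def FactRing_def)
  show "B_gen K G s i = pr (word [i])"
    by (simp add: B_gen_def)
qed

lemma B_ring: "ring B"
proof -
  have "(\<lambda>f. pr f) \<in> ring_hom F B"
    by (rule ring_hom_memI) auto
  from F.ring_hom_imp_img_ring[OF this] have "ring (B\<lparr>carrier := carrier B, zero := \<zero>\<^bsub>B\<^esub>\<rparr>)"
    by simp
  then show ?thesis by (simp del: B_simps)
qed

sublocale B: ring B by (rule B_ring)

text \<open>The map induced on the quotient: \<open>unital_walk_map\<close> is constant on cosets of
  its kernel \<open>I\<close>, so the image of a coset is a singleton.\<close>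

definition B_iso :: "('v list \<Rightarrow> 'k) set \<Rightarrow> 'k \<times> ('v list set \<Rightarrow> 'k)"
  where "B_iso X = the_elem (unital_walk_map ` X)"

lemma B_iso_pr [simp]: "f \<in> carrier F \<Longrightarrow> B_iso (pr f) = (f [], walk_map f)"
  using walk_map.the_elem_simp[of f] unfolding kernel_unital_walk_map
  by (simp add: B_iso_def unital_walk_map_def)

lemma B_iso: "B_iso \<in> algebra_iso K B U"
proof -
  have "B_iso \<in> ring_iso (F Quot I) U"
    using walk_map.FactRing_iso_set[OF unital_walk_map_surj]
    unfolding kernel_unital_walk_map B_iso_def .
  then have "B_iso \<in> ring_iso B U"
    by (simp add: ring_iso_def ring_hom_def B_algebra_def quotient_algebra_def)
  then show ?thesis
    by (auto simp: algebra_iso_def pr_smult) (simp_all add: unitization_def)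
qed

section \<open>The augmentation ideal\<close>

abbreviation "J \<equiv> carrier (B_plus K G s)"

lemma B_plus_carrier_eq: "J = Idl\<^bsub>B\<^esub> (B_gen K G s ` pverts G)"
  unfolding B_plus_def by (simp del: B_simps)

lemma B_gen_closed: "B_gen K G s ` pverts G \<subseteq> carrier B"
  by auto

lemma J_ideal: "ideal J B"
  unfolding B_plus_carrier_eq by (rule B.genideal_ideal[OF B_gen_closed])

lemma B_gen_in_J: "i \<in> pverts G \<Longrightarrow> pr (word [i]) \<in> J"
  unfolding B_plus_carrier_eq using B.genideal_self[OF B_gen_closed] B_simps(6)[of i] by blast

lemma J_pr_closed:
  assumes "pr f \<in> J" "f \<in> carrier F"
  shows "g \<in> carrier F \<Longrightarrow> pr (f \<otimes>\<^bsub>F\<^esub> g) \<in> J" "g \<in> carrier F \<Longrightarrow> pr (g \<otimes>\<^bsub>F\<^esub> f) \<in> J"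
    "g \<in> carrier F \<Longrightarrow> pr g \<in> J \<Longrightarrow> pr (f \<oplus>\<^bsub>F\<^esub> g) \<in> J" "k \<in> carrier K \<Longrightarrow> pr (k \<odot>\<^bsub>F\<^esub> f) \<in> J"
proof -
  interpret J: ideal J B by (rule J_ideal)
  show *: "pr (g \<otimes>\<^bsub>F\<^esub> f) \<in> J" if "g \<in> carrier F" for g
    using J.I_l_closed[OF assms(1), of "pr g"] that assms(2) by simp
  show "pr (f \<otimes>\<^bsub>F\<^esub> g) \<in> J" if "g \<in> carrier F"
    using J.I_r_closed[OF assms(1), of "pr g"] that assms(2) by simp
  show "pr (f \<oplus>\<^bsub>F\<^esub> g) \<in> J" if "g \<in> carrier F" "pr g \<in> J"
    using J.a_closed[OF assms(1) that(2)] that(1) assms(2) by simp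
  show "pr (k \<odot>\<^bsub>F\<^esub> f) \<in> J" if "k \<in> carrier K"
    using *[of "k \<odot>\<^bsub>F\<^esub> \<one>\<^bsub>F\<^esub>"] that assms(2) by simp
qed

lemma augmentation_induct [consumes 2, case_names zero vertex Cons add smult]:
  assumes "f \<in> carrier F" "f [] = \<zero>"
    and zero: "P \<zero>\<^bsub>F\<^esub>"
    and vertex: "\<And>i. i \<in> pverts G \<Longrightarrow> P (word [i])"
    and Cons: "\<And>i w. i \<in> pverts G \<Longrightarrow> w \<in> lists (pverts G) \<Longrightarrow> w \<noteq> [] \<Longrightarrow> P (word w) \<Longrightarrow> P (word (i # w))"
    and add: "\<And>f g. f \<in> carrier F \<Longrightarrow> g \<in> carrier F \<Longrightarrow> P f \<Longrightarrow> P g \<Longrightarrow> P (f \<oplus>\<^bsub>F\<^esub> g)"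
    and smult: "\<And>k f. k \<in> carrier K \<Longrightarrow> f \<in> carrier F \<Longrightarrow> P f \<Longrightarrow> P (k \<odot>\<^bsub>F\<^esub> f)"
  shows "P f"
proof -
  \<comment> \<open>Functions vanishing at the empty word form the free module on the nonempty
    words, so induction over this smaller basis applies.\<close>
  let ?F' = "basis_algebra K (lists (pverts G) - {[]}) (@) {[]}"
  have F': "carrier ?F' \<subseteq> carrier F" "\<And>f g. f \<oplus>\<^bsub>?F'\<^esub> g = f \<oplus>\<^bsub>F\<^esub> g"
    "\<And>k f. k \<odot>\<^bsub>?F'\<^esub> f = k \<odot>\<^bsub>F\<^esub> f" "\<zero>\<^bsub>?F'\<^esub> = \<zero>\<^bsub>F\<^esub>"
    by (auto simp: free_algebra_def basis_algebra_simps basis_algebra_carrier_iff)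
  have word: "P (word w)" if "w \<in> lists (pverts G)" "w \<noteq> []" for w
    using that
  proof (induction w)
    case (Cons i w)
    then show ?case
      using vertex assms(5)[of i w] by (cases "w = []") auto
  qed simp
  have "f \<in> carrier ?F'"
    using assms(1,2) by (auto simp: free_algebra_def basis_algebra_carrier_iff)
  then show ?thesis
  proof (induction rule: basis_algebra_induct)
    case (add f g)
    then show ?case
      using assms(6)[of f g] F' by auto
  next
    case (smult k f)
    then show ?case
      using assms(7)[of k f] F' by auto
  qed (use F'(4) zero word in simp_all)
qed

text \<open>The ideal generated by the \<open>x_i\<close> is the kernel of the augmentation: the
  augmentation kills each generator, and conversely every nonempty word has a generator as a
  factor.\<close>

lemma B_plus_carrier: "J = (\<lambda>f. pr f) ` {f \<in> carrier F. f [] = \<zero>}"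
proof
  \<comment> \<open>The first component of \<open>B_iso\<close> is the augmentation, already known
    to be well defined on cosets.\<close>
  have hom: "(\<lambda>X. fst (B_iso X)) \<in> ring_hom B K"
    by (rule ring_hom_memI) (auto simp: mult_apply_Nil simp flip: word_Nil)
  interpret aug: ring_hom_ring B K "\<lambda>X. fst (B_iso X)"
    by (rule ring_hom_ringI2[OF B_ring ring_axioms hom])
  have "B_gen K G s i \<in> a_kernel B K (\<lambda>X. fst (B_iso X))" if "i \<in> pverts G" for i
    using that unfolding a_kernel_def' by simp
  then have "J \<subseteq> a_kernel B K (\<lambda>X. fst (B_iso X))"
    unfolding B_plus_carrier_eq by (intro B.genideal_minimal aug.kernel_is_ideal image_subsetI)
  then have kernel: "X \<in> carrier B \<and> fst (B_iso X) = \<zero>" if "X \<in> J" for X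
    using that unfolding a_kernel_def' by blast
  show "J \<subseteq> (\<lambda>f. pr f) ` {f \<in> carrier F. f [] = \<zero>}"
  proof
    fix X assume "X \<in> J"
    with kernel have X: "X \<in> carrier B" "fst (B_iso X) = \<zero>" by blast+
    then obtain f where f: "f \<in> carrier F" "X = pr f" by (simp, blast)
    then show "X \<in> (\<lambda>f. pr f) ` {f \<in> carrier F. f [] = \<zero>}"
      using X(2) by simp
  qed
  have "pr f \<in> J" if "f \<in> carrier F" "f [] = \<zero>" for f
    using that
  proof (induction rule: augmentation_induct)
    case zero
    then show ?case
      using additive_subgroup.zero_closed[OF ideal.axioms(1)[OF J_ideal]] by simp
  next
    case (Cons i w)
    then show ?case
      using J_pr_closed(2)[of "word w" "word [i]"] word_append[of "[i]" w] by simp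
  qed (use B_gen_in_J J_pr_closed in auto)
  then show "(\<lambda>f. pr f) ` {f \<in> carrier F. f [] = \<zero>} \<subseteq> J"
    by blast
qed

lemma B_plus_fields [simp]:
  "x \<otimes>\<^bsub>B_plus K G s\<^esub> y = x \<otimes>\<^bsub>B\<^esub> y" "x \<oplus>\<^bsub>B_plus K G s\<^esub> y = x \<oplus>\<^bsub>B\<^esub> y"
  "k \<odot>\<^bsub>B_plus K G s\<^esub> x = k \<odot>\<^bsub>B\<^esub> x"
  by (simp_all add: B_plus_def)

text \<open>Nonempty words are products of generators with all partial products inside
  \<open>J\<close>, so values on the generators propagate by multiplicativity and linearity to all
  of \<open>J\<close>.\<close>

lemma B_plus_iso_unique:
  assumes \<phi>: "\<phi> \<in> nonunital_algebra_iso K (B_plus K G s) H"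
    and \<phi>': "\<phi>' \<in> nonunital_algebra_iso K (B_plus K G s) H"
    and gen: "\<And>i. i \<in> pverts G \<Longrightarrow> \<phi> (B_gen K G s i) = \<phi>' (B_gen K G s i)"
    and b: "b \<in> J"
  shows "\<phi> b = \<phi>' b"
proof -
  have hom_mult: "\<chi> (x \<otimes>\<^bsub>B\<^esub> y) = \<chi> x \<otimes>\<^bsub>H\<^esub> \<chi> y" and hom_add: "\<chi> (x \<oplus>\<^bsub>B\<^esub> y) = \<chi> x \<oplus>\<^bsub>H\<^esub> \<chi> y"
    and hom_smult: "k \<in> carrier K \<Longrightarrow> \<chi> (k \<odot>\<^bsub>B\<^esub> x) = k \<odot>\<^bsub>H\<^esub> \<chi> x" and closed: "\<chi> x \<in> carrier H"
    if "\<chi> \<in> nonunital_algebra_iso K (B_plus K G s) H" "x \<in> J" "y \<in> J" for \<chi> x y k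
    using that by (auto simp: nonunital_algebra_iso_def hom_def Pi_iff simp del: homotope_simps)
  \<comment> \<open>Membership in \<open>J\<close> is carried along because the homomorphism laws
    are available only there.\<close>
  have "pr f \<in> J \<and> \<phi> (pr f) = \<phi>' (pr f)" if "f \<in> carrier F" "f [] = \<zero>" for f
    using that
  proof (induction rule: augmentation_induct)
    case zero
    have z: "pr \<zero>\<^bsub>F\<^esub> \<in> J"
      unfolding B_plus_carrier by auto
    \<comment> \<open>Zero is the scalar zero times itself, so compatibility with scalars forces its
      image to be zero.\<close>
    have "\<chi> (pr \<zero>\<^bsub>F\<^esub>) = \<zero>\<^bsub>A\<^esub>" if "\<chi> \<in> nonunital_algebra_iso K (B_plus K G s) H" for \<chi>
      using hom_smult[OF that z z zero_closed] closed[OF that z z] pr_smult[OF zero_closed F.zero_closed]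
      by simp
    then show ?case using z \<phi> \<phi>' by simp
  next
    case (vertex i)
    then show ?case using gen B_gen_in_J by simp
  next
    case (Cons i w)
    have i: "pr (word [i]) \<in> J" "\<phi> (pr (word [i])) = \<phi>' (pr (word [i]))"
      using Cons gen B_gen_in_J by auto
    have e: "pr (word (i # w)) = pr (word [i]) \<otimes>\<^bsub>B\<^esub> pr (word w)"
      using Cons word_append[of "[i]" w] by simp
    then show ?case
      using Cons i hom_mult[OF \<phi>, of "pr (word [i])" "pr (word w)"] hom_mult[OF \<phi>', of "pr (word [i])" "pr (word w)"]
        J_pr_closed(2)[of "word w" "word [i]"]
      by simp
  next
    case (add f g)
    then show ?case
      using J_pr_closed(3)[of f g] hom_add[OF \<phi>, of "pr f" "pr g"] hom_add[OF \<phi>', of "pr f" "pr g"]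
      by simp
  next
    case (smult k f)
    then show ?case
      using J_pr_closed(4)[of f k] hom_smult[OF \<phi>, of "pr f" "pr f" k]
        hom_smult[OF \<phi>', of "pr f" "pr f" k] by (simp add: pr_smult)
  qed
  then show ?thesis using b unfolding B_plus_carrier by blast
qed

text \<open>On \<open>J\<close> the first component of \<open>B_iso\<close> is zero. Hence the
  second component alone stays injective, and the two scalar terms in \<open>walk_map_mult\<close>
  disappear, leaving the product of the homotope.\<close>

lemma B_plus_iso: "(\<lambda>X. snd (B_iso X)) \<in> nonunital_algebra_iso K (B_plus K G s) H"
proof -
  have "inj_on (\<lambda>X. snd (B_iso X)) J"
  proof (rule inj_onI)
    fix X Y assume XY: "X \<in> J" "Y \<in> J" "snd (B_iso X) = snd (B_iso Y)"
    then have "B_iso X = B_iso Y" "X \<in> carrier B" "Y \<in> carrier B"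
      by (auto simp: B_plus_carrier)
    moreover have "inj_on B_iso (carrier B)"
      using B_iso by (auto simp: algebra_iso_def ring_iso_def bij_betw_def)
    ultimately show "X = Y" by (metis inj_onD)
  qed
  moreover have "(\<lambda>X. snd (B_iso X)) ` J = carrier H"
  proof
    show "carrier H \<subseteq> (\<lambda>X. snd (B_iso X)) ` J"
    proof
      fix g assume "g \<in> carrier H"
      then have g: "g \<in> carrier A" by simp
      then have "pr (class_map g) \<in> J" "snd (B_iso (pr (class_map g))) = g"
        by (auto simp: B_plus_carrier walk_map_class_map)
      then show "g \<in> (\<lambda>X. snd (B_iso X)) ` J" by force
    qed
  qed (auto simp: B_plus_carrier)
  moreover have "snd (B_iso (X \<otimes>\<^bsub>B\<^esub> Y)) = snd (B_iso X) \<otimes>\<^bsub>H\<^esub> snd (B_iso Y) \<and>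
      snd (B_iso (X \<oplus>\<^bsub>B\<^esub> Y)) = snd (B_iso X) \<oplus>\<^bsub>H\<^esub> snd (B_iso Y)" if "X \<in> J" "Y \<in> J" for X Y
    using that by (auto simp: B_plus_carrier walk_map_mult)
  moreover have "snd (B_iso (k \<odot>\<^bsub>B\<^esub> X)) = k \<odot>\<^bsub>H\<^esub> snd (B_iso X)" if "k \<in> carrier K" "X \<in> J" for k X
    using that by (auto simp: B_plus_carrier pr_smult)
  ultimately show ?thesis
    by (auto simp: nonunital_algebra_iso_def hom_def bij_betw_def simp del: homotope_simps)
qed

end

text \<open>Maps are total functions here, so two isomorphisms are compared on the carrier only. The
  last clause makes the unital isomorphism an extension of the non-unital one.\<close>

theorem theorem8:
  fixes K :: "('k, 'm) ring_scheme"
    and G :: "'v pair_pre_digraph"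
    and s :: "'v \<Rightarrow> 'v \<Rightarrow> 'k"
  assumes "cring K"
    and "pair_graph G"
    and "\<And>i j. (i, j) \<in> parcs G \<Longrightarrow> s i j \<in> Units K"
    and "\<And>i j. (i, j) \<in> parcs G \<Longrightarrow> s i j = s j i"
  shows "\<exists>\<phi>. \<phi> \<in> nonunital_algebra_iso K (B_plus K G s) (groupoid_homotope K G s) \<and>
      (\<forall>i\<in>pverts G. \<phi> (B_gen K G s i) = vertex_elem K G i) \<and>
      (\<forall>\<phi>'\<in>nonunital_algebra_iso K (B_plus K G s) (groupoid_homotope K G s).
        (\<forall>i\<in>pverts G. \<phi>' (B_gen K G s i) = vertex_elem K G i) \<longrightarrow>
        (\<forall>b\<in>carrier (B_plus K G s). \<phi>' b = \<phi> b)) \<and>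
      (\<exists>\<psi>\<in>algebra_iso K (B_algebra K G s) (unitization K (groupoid_homotope K G s)).
        (\<forall>i\<in>pverts G. \<psi> (B_gen K G s i) = (\<zero>\<^bsub>K\<^esub>, vertex_elem K G i)) \<and>
        (\<forall>b\<in>carrier (B_plus K G s). \<psi> b = (\<zero>\<^bsub>K\<^esub>, \<phi> b)))"
proof -
  interpret edge_weighted_graph K G s
    using assms by (intro edge_weighted_graph.intro edge_weighted_graph_axioms.intro)
  have gen: "B_iso (B_gen K G s i) = (\<zero>\<^bsub>K\<^esub>, vertex_elem K G i)" if "i \<in> pverts G" for i
    using that by simp
  have J: "B_iso b = (\<zero>\<^bsub>K\<^esub>, snd (B_iso b))" if "b \<in> carrier (B_plus K G s)" for b
    using that by (auto simp: B_plus_carrier)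
  show ?thesis
  proof (intro exI[of _ "\<lambda>X. snd (B_iso X)"] conjI ballI impI bexI[of _ B_iso])
    fix \<phi>' b
    assume \<phi>': "\<phi>' \<in> nonunital_algebra_iso K (B_plus K G s) (groupoid_homotope K G s)"
      and "\<forall>i\<in>pverts G. \<phi>' (B_gen K G s i) = vertex_elem K G i"
      and b: "b \<in> carrier (B_plus K G s)"
    then show "\<phi>' b = snd (B_iso b)"
      using B_plus_iso_unique[OF \<phi>' B_plus_iso _ b] gen by simp
  qed (use B_plus_iso B_iso gen J in simp_all)
qed

end
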